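(* Let $n\ge 1$, let $\lambda=(\lambda_1,\ldots,\lambda_s)\vdash n$, and let $\lambda^{*}\vdash n$ be the largest partition in lexicographic order among all the partitions of $n$ with $\lambda_1$ as their first part. Then $$|\eta_{(\lambda_1,1^{n-\lambda_1})}|\le|\eta_\lambda|\le|\eta_{\lambda^{*}}|.$$
   Context: A partition $\lambda\vdash n$ is a weakly decreasing sequence $\lambda_1\ge\cdots\ge\lambda_s\ge 1$ of positive integers with sum $n$. The notation $(\lambda_1,1^{n-\lambda_1})$ means the partition with first part $\lambda_1$ followed by $n-\lambda_1$ parts equal to $1$. Lexicographic order on partitions of $n$: $\lambda<_{\mathrm{lex}}\lambda'$ if there is $m$ with $\lambda_i=\lambda'_i$ for $i<m$ and $\lambda_m<\lambda'_m$. The derangement graph $\Gamma_n$ is the Cayley graph of the symmetric group $\mathcal S_n$ whose connection set is the set $\mathcal D_n$ of derangements (fixed-point-free permutations) of $\{1,\dots,n\}$. Its eigenvalues are indexed by partitions $\lambda\vdash n$ and are $$\eta_\lambda=\frac{1}{\chi_\lambda(1)}\sum_{s\in\mathcal D_n}\chi_\lambda(s),$$ where $\chi_\lambda$ is the irreducible character of $\mathcal S_n$ indexed by $\lambda$ (standard labelling: $(n)$ is the trivial character, $(1^n)$ the sign character). *)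

theory Defs
  imports Complex_Main "HOL-Library.Function_Algebras" "HOL-Combinatorics.Permutations"
begin

definition partition_of :: "nat list \<Rightarrow> nat \<Rightarrow> bool" (infix "\<turnstile>" 50) where
  "lam \<turnstile> n \<longleftrightarrow> sorted_wrt (\<ge>) lam \<and> (\<forall>x\<in>set lam. x \<ge> 1) \<and> sum_list lam = n"

definition lex_less :: "nat list \<Rightarrow> nat list \<Rightarrow> bool" (infix "<\<^sub>l\<^sub>e\<^sub>x" 50) where
  "lam <\<^sub>l\<^sub>e\<^sub>x mu \<longleftrightarrow>
     (\<exists>m. m < length lam \<and> m < length mu \<and> (\<forall>i<m. lam ! i = mu ! i) \<and> lam ! m < mu ! m)"

lemma lex_less_linear:
  assumes "lam \<turnstile> n" "mu \<turnstile> n"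
  shows "lam <\<^sub>l\<^sub>e\<^sub>x mu \<or> lam = mu \<or> mu <\<^sub>l\<^sub>e\<^sub>x lam"
  using assms
proof (induction lam arbitrary: mu n)
  case Nil
  then show ?case by (cases mu) (auto simp: partition_of_def)
next
  case (Cons a lam)
  then obtain b mu' where mu: "mu = b # mu'"
    by (cases mu) (auto simp: partition_of_def)
  show ?case
  proof (cases "a = b")
    case False
    then show ?thesis unfolding mu lex_less_def by (cases a b rule: linorder_cases) (auto intro: exI[of _ 0])
  next
    case True
    have p: "lam \<turnstile> n - a" "mu' \<turnstile> n - a"
      using Cons.prems unfolding mu True partition_of_def by auto
    have step: "(a # x) <\<^sub>l\<^sub>e\<^sub>x (a # y)" if "x <\<^sub>l\<^sub>e\<^sub>x y" for x y
    proof -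
      from that obtain m where "m < length x" "m < length y" "\<forall>i<m. x ! i = y ! i" "x ! m < y ! m"
        unfolding lex_less_def by blast
      then show ?thesis unfolding lex_less_def
        by (intro exI[of _ "Suc m"]) (auto simp: nth_Cons split: nat.split)
    qed
    show ?thesis using Cons.IH[OF p] step unfolding mu True by blast
  qed
qed

lemma lex_less_irrefl: "\<not> lam <\<^sub>l\<^sub>e\<^sub>x lam"
  by (auto simp: lex_less_def)

lemma lex_less_trans:
  assumes "x <\<^sub>l\<^sub>e\<^sub>x y" "y <\<^sub>l\<^sub>e\<^sub>x z"
  shows "x <\<^sub>l\<^sub>e\<^sub>x z"
proof -
  obtain i where i: "i < length x" "i < length y" "\<forall>k<i. x ! k = y ! k" "x ! i < y ! i"
    using assms(1) unfolding lex_less_def by blast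
  obtain j where j: "j < length y" "j < length z" "\<forall>k<j. y ! k = z ! k" "y ! j < z ! j"
    using assms(2) unfolding lex_less_def by blast
  show ?thesis unfolding lex_less_def
  proof (cases i j rule: linorder_cases)
    case less
    then show "\<exists>m. m < length x \<and> m < length z \<and> (\<forall>i<m. x ! i = z ! i) \<and> x ! m < z ! m"
      using i j by (intro exI[of _ i]) simp
  next
    case equal
    then show "\<exists>m. m < length x \<and> m < length z \<and> (\<forall>i<m. x ! i = z ! i) \<and> x ! m < z ! m"
      using i j by (intro exI[of _ i]) auto
  next
    case greater
    then show "\<exists>m. m < length x \<and> m < length z \<and> (\<forall>i<m. x ! i = z ! i) \<and> x ! m < z ! m"
      using i j by (intro exI[of _ j]) simp
  qed
qed

lemma finite_partitions: "finite {lam. lam \<turnstile> n}"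
proof (rule finite_subset)
  have "length l \<le> sum_list l" if "\<forall>x\<in>set l. x \<ge> 1" for l :: "nat list"
    using that by (induction l) auto
  then show "{lam. lam \<turnstile> n} \<subseteq> {lam. set lam \<subseteq> {..n} \<and> length lam \<le> n}"
    using member_le_sum_list by (fastforce simp: partition_of_def)
  show "finite {lam. set lam \<subseteq> {..n} \<and> length lam \<le> n}"
    by (rule finite_lists_length_le) simp
qed

definition lex_largest_with_first_part :: "nat \<Rightarrow> nat \<Rightarrow> nat list \<Rightarrow> bool" where
  "lex_largest_with_first_part n k mu \<longleftrightarrow>
     mu \<turnstile> n \<and> hd mu = k \<and> (\<forall>nu. nu \<turnstile> n \<and> hd nu = k \<and> nu \<noteq> mu \<longrightarrow> nu <\<^sub>l\<^sub>e\<^sub>x mu)"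

lemma ex1_lex_largest_with_first_part:
  assumes "lam \<turnstile> n"
  shows "\<exists>!mu. lex_largest_with_first_part n (hd lam) mu"
proof -
  have fin: "finite A \<Longrightarrow> A \<noteq> {} \<Longrightarrow> A \<subseteq> {nu. nu \<turnstile> n} \<Longrightarrow> \<exists>m\<in>A. \<forall>nu\<in>A. nu \<noteq> m \<longrightarrow> nu <\<^sub>l\<^sub>e\<^sub>x m" for A
  proof (induction A rule: finite_ne_induct)
    case (singleton x)
    then show ?case by simp
  next
    case (insert x F)
    then obtain m where m: "m \<in> F" "\<forall>nu\<in>F. nu \<noteq> m \<longrightarrow> nu <\<^sub>l\<^sub>e\<^sub>x m" by auto
    have "x <\<^sub>l\<^sub>e\<^sub>x m \<or> x = m \<or> m <\<^sub>l\<^sub>e\<^sub>x x"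
      using insert.prems m(1) by (intro lex_less_linear) auto
    then consider "x = m \<or> x <\<^sub>l\<^sub>e\<^sub>x m" | "m <\<^sub>l\<^sub>e\<^sub>x x" by blast
    then show ?case
    proof cases
      case 1
      then show ?thesis using m by (intro bexI[of _ m]) auto
    next
      case 2
      have "nu <\<^sub>l\<^sub>e\<^sub>x x" if "nu \<in> F" for nu
        using that m(2) 2 lex_less_trans[of nu m x] by (cases "nu = m") auto
      then show ?thesis by (intro bexI[of _ x]) auto
    qed
  qed
  let ?A = "{nu. nu \<turnstile> n \<and> hd nu = hd lam}"
  have "finite ?A" by (rule finite_subset[OF _ finite_partitions[of n]]) auto
  then have "\<exists>m\<in>?A. \<forall>nu\<in>?A. nu \<noteq> m \<longrightarrow> nu <\<^sub>l\<^sub>e\<^sub>x m"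
    using assms by (intro fin) auto
  then obtain m where "m \<in> ?A" and m: "\<forall>nu\<in>?A. nu \<noteq> m \<longrightarrow> nu <\<^sub>l\<^sub>e\<^sub>x m" by (elim bexE)
  then show ?thesis unfolding lex_largest_with_first_part_def
  proof (intro ex1I[of _ m])
    fix mu assume *: "mu \<turnstile> n \<and> hd mu = hd lam \<and> (\<forall>nu. nu \<turnstile> n \<and> hd nu = hd lam \<and> nu \<noteq> mu \<longrightarrow> nu <\<^sub>l\<^sub>e\<^sub>x mu)"
    show "mu = m"
    proof (rule ccontr)
      assume "mu \<noteq> m"
      with * \<open>m \<in> ?A\<close> have "m <\<^sub>l\<^sub>e\<^sub>x mu" by auto
      moreover have "mu <\<^sub>l\<^sub>e\<^sub>x m" using * m \<open>mu \<noteq> m\<close> by auto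
      ultimately show False using lex_less_trans[of m mu m] lex_less_irrefl by simp
    qed
  qed (use \<open>m \<in> ?A\<close> m in auto)
qed

text \<open>
  The irreducible representation labelled by \<open>lam\<close> is constructed as the left ideal of the
  complex group algebra generated by the Young symmetrizer of the tableau of shape \<open>lam\<close> whose
  boxes are filled with \<open>1, \<dots>, n\<close> row by row. \<open>tab_row\<close> (counted from 0) and
  \<open>tab_col\<close> (counted from 1) locate the box containing the entry \<open>k\<close>.
\<close>

definition tab_row :: "nat list \<Rightarrow> nat \<Rightarrow> nat" where
  "tab_row lam k = (LEAST i. k \<le> sum_list (take (Suc i) lam))"

definition tab_col :: "nat list \<Rightarrow> nat \<Rightarrow> nat" where
  "tab_col lam k = k - sum_list (take (tab_row lam k) lam)"

definition sym_group :: "nat \<Rightarrow> (nat \<Rightarrow> nat) set" where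
  "sym_group n = {p. p permutes {1..n}}"

definition row_group :: "nat list \<Rightarrow> (nat \<Rightarrow> nat) set" where
  "row_group lam = {p \<in> sym_group (sum_list lam).
     \<forall>k\<in>{1..sum_list lam}. tab_row lam (p k) = tab_row lam k}"

definition col_group :: "nat list \<Rightarrow> (nat \<Rightarrow> nat) set" where
  "col_group lam = {q \<in> sym_group (sum_list lam).
     \<forall>k\<in>{1..sum_list lam}. tab_col lam (q k) = tab_col lam k}"

text \<open>
  An element of the group algebra is the function giving its coefficients; left multiplication by
  the group element \<open>s\<close> is \<open>left_mult s\<close>, and the Young symmetrizer is the product of the sum of
  the row group and the signed sum of the column group.
\<close>

type_synonym group_algebra = "(nat \<Rightarrow> nat) \<Rightarrow> complex"

definition left_mult :: "(nat \<Rightarrow> nat) \<Rightarrow> group_algebra \<Rightarrow> group_algebra" where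
  "left_mult s f = (\<lambda>x. f (inv s \<circ> x))"

definition young_symmetrizer :: "nat list \<Rightarrow> group_algebra" where
  "young_symmetrizer lam =
     (\<lambda>x. \<Sum>p\<in>row_group lam. \<Sum>q\<in>col_group lam. if x = p \<circ> q then of_int (sign q) else 0)"

global_interpretation cfun: vector_space "\<lambda>(c::complex) (f::'a \<Rightarrow> complex) x. c * f x"
  by unfold_locales (auto simp: fun_eq_iff algebra_simps)

definition irrep_space :: "nat list \<Rightarrow> group_algebra set" where
  "irrep_space lam =
     cfun.span ((\<lambda>s. left_mult s (young_symmetrizer lam)) ` sym_group (sum_list lam))"

text \<open>
  The trace of a linear endomorphism \<open>T\<close> of a finite-dimensional subspace \<open>V\<close>; it does not depend on
  the choice of the basis.
\<close>

definition trace_on :: "('a \<Rightarrow> complex) set \<Rightarrow> (('a \<Rightarrow> complex) \<Rightarrow> 'a \<Rightarrow> complex) \<Rightarrow> complex" where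
  "trace_on V T =
     (let B = (SOME B. cfun.independent B \<and> cfun.span B = V)
      in \<Sum>b\<in>B. cfun.representation B (T b) b)"

definition irr_char :: "nat list \<Rightarrow> (nat \<Rightarrow> nat) \<Rightarrow> complex" where
  "irr_char lam s = trace_on (irrep_space lam) (left_mult s)"

definition derangements :: "nat \<Rightarrow> (nat \<Rightarrow> nat) set" where
  "derangements n = {s \<in> sym_group n. \<forall>i\<in>{1..n}. s i \<noteq> i}"

text \<open>The eigenvalue of the derangement graph on \<open>sum_list lam\<close> points that is indexed by \<open>lam\<close>.\<close>

definition eta :: "nat list \<Rightarrow> complex" where
  "eta lam = 1 / irr_char lam id * (\<Sum>s\<in>derangements (sum_list lam). irr_char lam s)"

end

theory Submission
  imports Defs
begin

text \<open>
  The class sum of the derangements is central, so it maps the Young symmetrizer to another element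
  that is invariant under the row group and alternating under the column group; by von Neumann's
  lemma it is a multiple of the symmetrizer, and the factor is \<open>\<eta>\<close>. Reading off the coefficient at
  the identity and applying inclusion-exclusion over the common fixed points gives
  \<open>\<eta> = (\<Sum>T. (-1) ^ (n - |T|) * (\<Prod>i. t\<^sub>i!))\<close>, where \<open>T\<close> ranges over the sets of boxes with at most one
  box in each column and \<open>t\<^sub>i\<close> is the number of boxes of \<open>T\<close> in row \<open>i\<close>.

  Since \<open>t!\<close> is the \<open>t\<close>-th moment of an exponential variable, \<open>\<eta>\<close> is up to sign the expectation of the
  product of \<open>x\<^sub>1 + \<dots> + x\<^sub>c - 1\<close> over all column lengths \<open>c\<close>, with \<open>x\<^sub>1, x\<^sub>2, \<dots>\<close> independent exponential
  of mean 1. All moments of \<open>x\<^sub>1 - 1\<close> are nonnegative (they are derangement numbers), so this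
  expectation is nonnegative. It does not decrease when a box moves from a column of length \<open>a\<close> to a
  column of length \<open>b\<close> with \<open>1 \<le> b \<le> a - 2\<close>, because every factor that contains
  \<open>x\<^sub>a\<close> also contains \<open>x\<^sub>b\<^sub>+\<^sub>1\<close>, so that an extra factor \<open>x\<^sub>b\<^sub>+\<^sub>1\<close> is worth at least as much as
  \<open>x\<^sub>a\<close>. For a fixed number of columns the hook is therefore minimal and the shape with balanced columns, which is the lexicographically largest one, maximal.
\<close>

section \<open>Alternating sums over column transversals\<close>

text \<open>Multiplies the monomial with exponent vector \<open>t\<close> by the variable with index
  \<open>i\<close>; index 0 stands for the factor x_1 - 1.\<close>

definition inc :: "nat \<Rightarrow> (nat \<Rightarrow> nat) \<Rightarrow> nat \<Rightarrow> nat" where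
  "inc i t = t(i := Suc (t i))"

lemma inc_commute: "inc i (inc j t) = inc j (inc i t)"
  by (auto simp: inc_def fun_eq_iff)

fun shifted_moment :: "nat \<Rightarrow> nat \<Rightarrow> int" where
  "shifted_moment p 0 = fact p"
| "shifted_moment p (Suc q) = shifted_moment (Suc p) q - shifted_moment p q"

text \<open>Integration by parts.\<close>

lemma shifted_moment_rec:
  "shifted_moment (Suc p) q =
     int (Suc p) * shifted_moment p q + int q * shifted_moment (Suc p) (q - 1)"
proof (induction q arbitrary: p)
  case 0
  then show ?case by simp
next
  case (Suc q)
  have IH: "shifted_moment (Suc p) q =
     int (Suc p) * shifted_moment p q + int q * shifted_moment (Suc p) (q - 1)" for p
    by (rule Suc.IH)
  have "int q * shifted_moment (Suc (Suc p)) (q - 1) =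
     int q * (shifted_moment (Suc p) q + shifted_moment (Suc p) (q - 1))"
    by (cases q) auto
  then show ?case
    using IH[of p] IH[of "Suc p"] by (simp add: algebra_simps)
qed

text \<open>The recursion has nonnegative coefficients, which settles positive \<open>p\<close>. For
  \<open>p = 0\<close> it combines with the definition to E[(x - 1)^(q + 1)] = q
  E[x (x - 1)^(q - 1)]; this refers to \<open>p = 1\<close> at a smaller exponent, hence the outer
  induction over all \<open>p\<close>.\<close>

lemma shifted_moment_nonneg: "0 \<le> shifted_moment p q"
proof (induction q arbitrary: p rule: less_induct)
  case (less q)
  note outer = this
  show ?case
  proof (induction p)
    case 0
    show ?case
    proof (cases q)
      case (Suc q')
      have "shifted_moment 0 q = int q' * shifted_moment 1 (q' - 1)"
        using shifted_moment_rec[of 0 q'] Suc by simp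
      moreover have "0 \<le> shifted_moment 1 (q' - 1)"
        using outer[of "q' - 1" 1] Suc by simp
      ultimately show ?thesis by simp
    qed simp
  next
    case (Suc p)
    have "0 \<le> int q * shifted_moment (Suc p) (q - 1)"
      using outer[of "q - 1" "Suc p"] by (cases q) auto
    then show ?case using shifted_moment_rec[of p q] Suc by simp
  qed
qed

definition weight :: "nat \<Rightarrow> (nat \<Rightarrow> nat) \<Rightarrow> int" where
  "weight N t = shifted_moment (t 1) (t 0) * (\<Prod>i=2..N. fact (t i))"

text \<open>
  If \<open>x\<^sub>1, \<dots>, x\<^sub>N\<close> are independent exponential variables of mean 1, then \<open>shifted_moment p q\<close> is
  the expectation of \<open>x\<^sub>1 ^ p * (x\<^sub>1 - 1) ^ q\<close> and \<open>weight N t\<close> is that of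
  \<open>(x\<^sub>1 - 1) ^ t 0 * (\<Prod>i=1..N. x\<^sub>i ^ t i)\<close>; \<open>colsum N cs t\<close> is the expectation of the latter monomial
  multiplied by \<open>\<Prod>c\<leftarrow>cs. (x\<^sub>1 + \<dots> + x\<^sub>c - 1)\<close>.
\<close>

fun colsum :: "nat \<Rightarrow> nat list \<Rightarrow> (nat \<Rightarrow> nat) \<Rightarrow> int" where
  "colsum N [] t = weight N t"
| "colsum N (c # cs) t = (\<Sum>i=1..c. colsum N cs (inc i t)) - colsum N cs t"

lemma colsum_swap: "colsum N (a # b # cs) t = colsum N (b # a # cs) t"
  using sum.swap[of "\<lambda>i j. colsum N cs (inc i (inc j t))" "{1..a}" "{1..b}"]
  by (simp add: inc_commute sum_subtractf)

lemma colsum_cons_cong: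
  "(\<And>t. colsum N xs t = colsum N ys t) \<Longrightarrow> colsum N (x # xs) t = colsum N (x # ys) t"
  by simp

lemma colsum_move: "colsum N (xs @ y # ys) t = colsum N (y # xs @ ys) t"
proof (induction xs arbitrary: t)
  case (Cons x xs)
  have "colsum N (x # (xs @ y # ys)) t = colsum N (x # y # xs @ ys) t"
    by (rule colsum_cons_cong) (rule Cons.IH)
  then show ?case by (simp only: colsum_swap append_Cons)
qed simp

lemma colsum_mset: "mset xs = mset ys \<Longrightarrow> colsum N xs t = colsum N ys t"
proof (induction xs arbitrary: ys t)
  case (Cons x xs)
  then have "x \<in> set ys" by (metis list.set_intros(1) set_mset_mset)
  then obtain us vs where ys: "ys = us @ x # vs" by (meson split_list)
  with Cons.prems have "mset xs = mset (us @ vs)" by simp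
  then have "colsum N (x # xs) t = colsum N (x # us @ vs) t"
    by (intro colsum_cons_cong Cons.IH)
  then show ?case by (simp only: ys colsum_move)
qed simp

text \<open>Index 0 really acts as multiplication by x_1 - 1: without columns this is the defining
  recursion of \<open>shifted_moment\<close>, and the factors of the columns commute with
  it.\<close>

lemma colsum_inc_0: "colsum N cs (inc 0 t) = colsum N cs (inc 1 t) - colsum N cs t"
proof (induction cs arbitrary: t)
  case Nil
  have "(\<Prod>i=2..N. fact (inc k t i)) = (\<Prod>i=2..N. (fact (t i)::int))" if "k < 2" for k
    using that by (intro prod.cong) (auto simp: inc_def)
  from this[of 0] this[of 1] show ?case
    by (simp add: weight_def algebra_simps) (simp add: inc_def algebra_simps)
next
  case (Cons c cs)
  have "(\<Sum>i=1..c. colsum N cs (inc i (inc 0 t))) =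
     (\<Sum>i=1..c. colsum N cs (inc i (inc 1 t))) - (\<Sum>i=1..c. colsum N cs (inc i t))"
    unfolding sum_subtractf[symmetric]
    by (intro sum.cong refl) (metis Cons.IH inc_commute)
  then show ?case using Cons.IH[of t] by (simp add: inc_commute)
qed

text \<open>
  Expanding each factor as \<open>(x\<^sub>1 - 1) + x\<^sub>2 + \<dots> + x\<^sub>c\<close> removes all signs.
\<close>

lemma colsum_Cons:
  assumes "c \<ge> 1"
  shows "colsum N (c # cs) t = colsum N cs (inc 0 t) + (\<Sum>i=2..c. colsum N cs (inc i t))"
proof -
  have "(\<Sum>i=1..c. colsum N cs (inc i t)) =
      colsum N cs (inc 1 t) + (\<Sum>i=2..c. colsum N cs (inc i t))"
    using sum.atLeast_Suc_atMost[OF assms] by (simp add: numeral_2_eq_2)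
  then show ?thesis by (simp add: colsum_inc_0)
qed

text \<open>By \<open>colsum_Cons\<close> only sums of values with one column less occur, and the
  base case is a product of nonnegative moments. An empty column would contribute the factor
  -1.\<close>

lemma colsum_nonneg: "\<forall>c\<in>set cs. 1 \<le> c \<Longrightarrow> 0 \<le> colsum N cs t"
proof (induction cs arbitrary: t)
  case Nil
  then show ?case by (simp add: weight_def shifted_moment_nonneg prod_nonneg)
next
  case (Cons c cs)
  then show ?case
    using colsum_Cons[of c N cs t] by (auto intro!: add_nonneg_nonneg sum_nonneg)
qed

section \<open>Comparing column shapes by moving single boxes\<close>

text \<open>Log-convexity of the factorial, one unit at a time: each step multiplies the left side
  by b + d + 1 and the right side by a' + d + 1, and the hypotheses force b \<le> a'.\<close>

lemma fact_mult_spread: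
  assumes "a + b = a' + b'" "a' \<le> a" "b' \<le> (a::nat)"
  shows "fact a' * fact b' \<le> (fact a * fact b :: int)"
proof -
  define d where "d = a - a'"
  have "fact a' * fact (b + d) \<le> (fact (a' + d) * fact b :: int)"
  proof (induction d)
    case (Suc d)
    have "fact a' * fact (b + Suc d) = int (b + d + 1) * (fact a' * fact (b + d))"
      by (simp add: algebra_simps)
    also have "\<dots> \<le> int (a' + d + 1) * (fact (a' + d) * fact b)"
      using assms Suc by (intro mult_mono[OF _ Suc.IH]) auto
    finally show ?case by (simp add: algebra_simps)
  qed simp
  moreover have "b' = b + d" "a = a' + d" using assms by (auto simp: d_def)
  ultimately show ?thesis by simp
qed

text \<open>A more uneven pair of exponents of x_i and x_j gives a larger expectation. For bare
  monomials this is \<open>fact_mult_spread\<close>; it survives multiplication by a column factor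
  because, with i < j, a factor that contains x_j also contains x_i. Indices from 2 on keep clear of
  the shifted variable x_1.\<close>

lemma colsum_spread:
  assumes "2 \<le> i" "i < j" "j \<le> N" "\<forall>c\<in>set cs. 1 \<le> c"
    and "\<And>k. k \<noteq> i \<Longrightarrow> k \<noteq> j \<Longrightarrow> t k = t' k"
    and "t i + t j = t' i + t' j" "t' i \<le> t i" "t' j \<le> t i"
  shows "colsum N cs t' \<le> colsum N cs t"
  using assms(4-)
proof (induction cs arbitrary: t t')
  case Nil
  have split: "(\<Prod>k=2..N. fact (s k)) = fact (s i) * fact (s j) * (\<Prod>k\<in>{2..N} - {i, j}. (fact (s k)::int))"
    for s :: "nat \<Rightarrow> nat"
  proof -
    have "(\<Prod>k=2..N. (fact (s k)::int)) = (\<Prod>k\<in>{i,j}. fact (s k)) * (\<Prod>k\<in>{2..N} - {i, j}. fact (s k))"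
      using assms(1-3) by (subst mult.commute, intro prod.subset_diff) auto
    then show ?thesis using assms(2) by simp
  qed
  have "(\<Prod>k\<in>{2..N} - {i, j}. fact (t' k)) = (\<Prod>k\<in>{2..N} - {i, j}. (fact (t k)::int))"
    using Nil(2) by (intro prod.cong) auto
  moreover have "fact (t' i) * fact (t' j) \<le> (fact (t i) * fact (t j) :: int)"
    by (rule fact_mult_spread) (use Nil in auto)
  moreover have "t' 0 = t 0" "t' 1 = t 1"
    using Nil(2) assms(1,2) by auto
  ultimately show ?case
    unfolding colsum.simps weight_def split
    by (auto intro!: mult_left_mono mult_right_mono shifted_moment_nonneg prod_nonneg)
next
  case (Cons c cs)
  have c: "1 \<le> c" and cs: "\<forall>c\<in>set cs. 1 \<le> c" using Cons.prems by auto
  note IH = Cons.IH[OF cs]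
  have other: "colsum N cs (inc k t') \<le> colsum N cs (inc k t)" if "k \<noteq> i" "k \<noteq> j" for k
    by (rule IH) (use Cons.prems that in \<open>auto simp: inc_def\<close>)
  have ii: "colsum N cs (inc i t') \<le> colsum N cs (inc i t)"
    by (rule IH) (use Cons.prems assms(2) in \<open>auto simp: inc_def\<close>)
  have both: "colsum N cs (inc i t') + colsum N cs (inc j t') \<le> colsum N cs (inc i t) + colsum N cs (inc j t)"
  proof (cases "t i = t' i")
    case True
    then have "t = t'" using Cons.prems by (auto simp: fun_eq_iff) metis
    then show ?thesis by simp
  next
    case False
    \<comment> \<open>The terms are paired crosswise: comparing \<open>inc j t'\<close> with
      \<open>inc j t\<close> could violate the last hypothesis when \<open>t' j = t i\<close>,
      whereas \<open>t' i < t i\<close> leaves room for the crossed comparison.\<close>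
    have "colsum N cs (inc i t') \<le> colsum N cs (inc j t)"
      by (rule IH) (use Cons.prems assms(2) False in \<open>auto simp: inc_def\<close>)
    moreover have "colsum N cs (inc j t') \<le> colsum N cs (inc i t)"
      by (rule IH) (use Cons.prems assms(2) False in \<open>auto simp: inc_def\<close>)
    ultimately show ?thesis by simp
  qed
  \<comment> \<open>A factor reaching x_j contributes both special terms, bounded jointly by
    \<open>both\<close>; a shorter one contributes at most the term of x_i, bounded by
    \<open>ii\<close>.\<close>
  have "(\<Sum>k=2..c. colsum N cs (inc k t')) \<le> (\<Sum>k=2..c. colsum N cs (inc k t))"
  proof (cases "j \<le> c")
    case True
    have "{2..c} = {i,j} \<union> ({2..c} - {i,j})" using True assms(1,2) by auto
    then have split: "(\<Sum>k=2..c. f k) = f i + f j + (\<Sum>k\<in>{2..c} - {i,j}. f k)" for f :: "nat \<Rightarrow> int"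
      using assms(2) sum.union_disjoint[of "{i,j}" "{2..c} - {i,j}" f] by simp
    show ?thesis unfolding split by (rule add_mono[OF both sum_mono]) (use other in auto)
  next
    case False
    show ?thesis
    proof (rule sum_mono)
      fix k assume "k \<in> {2..c}"
      then show "colsum N cs (inc k t') \<le> colsum N cs (inc k t)"
        using other[of k] ii False by (cases "k = i") auto
    qed
  qed
  moreover have "colsum N cs (inc 0 t') \<le> colsum N cs (inc 0 t)"
    using other[of 0] assms(1,2) by simp
  ultimately show ?case by (simp add: colsum_Cons[OF c] del: colsum.simps)
qed

text \<open>With S_c = x_1 + ... + x_c - 1, the common product S_(a-1) S_b cancels, and x_a S_b has
  to be compared with x_(b+1) S_(a-1). First x_a is exchanged for x_(b+1) by
  \<open>colsum_spread\<close>, then S_b is extended to S_(a-1) by nonnegative terms.\<close>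

lemma colsum_balance_step:
  assumes "1 \<le> b" "b + 2 \<le> a" "a \<le> N" "\<forall>c\<in>set cs. 1 \<le> c" "\<forall>i\<ge>2. t i = 0"
  shows "colsum N (a # b # cs) t \<le> colsum N ((a - 1) # (b + 1) # cs) t"
proof -
  let ?F = "colsum N cs"
  have nn: "0 \<le> ?F s" for s using colsum_nonneg assms(4) by blast
  \<comment> \<open>As \<open>t\<close> vanishes from index 2 on and \<open>k\<close> differs from
    both \<open>b + 1\<close> and \<open>a\<close>, the exponents compared there are (1, 0) against
    (0, 1).\<close>
  have swap: "?F (inc k (inc a t)) \<le> ?F (inc k (inc (b + 1) t))" if "k \<le> b" for k
    by (rule colsum_spread[of "b + 1" a])
       (use assms that in \<open>auto simp: inc_def\<close>)
  have A: "colsum N (a # cs') s = colsum N ((a - 1) # cs') s + colsum N cs' (inc a s)" for cs' s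
    using assms(1,2) by (cases a) auto
  have "colsum N (a # b # cs) t = colsum N ((a - 1) # b # cs) t + colsum N (b # cs) (inc a t)"
    by (rule A)
  moreover have "colsum N ((a - 1) # (b + 1) # cs) t =
      colsum N ((a - 1) # b # cs) t + colsum N ((a - 1) # cs) (inc (b + 1) t)"
    by (subst (1 2) colsum_swap) (simp add: inc_commute)
  moreover have "colsum N (b # cs) (inc a t) \<le> colsum N ((a - 1) # cs) (inc (b + 1) t)"
  proof -
    have "colsum N (b # cs) (inc a t) = ?F (inc 0 (inc a t)) + (\<Sum>k=2..b. ?F (inc k (inc a t)))"
      by (rule colsum_Cons[OF assms(1)])
    also have "\<dots> \<le> ?F (inc 0 (inc (b + 1) t)) + (\<Sum>k=2..b. ?F (inc k (inc (b + 1) t)))"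
      by (intro add_mono sum_mono swap) auto
    also have "\<dots> \<le> ?F (inc 0 (inc (b + 1) t)) + (\<Sum>k=2..a - 1. ?F (inc k (inc (b + 1) t)))"
      using assms(2) nn by (intro add_left_mono sum_mono2) auto
    also have "\<dots> = colsum N ((a - 1) # cs) (inc (b + 1) t)"
      using assms(1,2) by (intro colsum_Cons[symmetric]) simp
    finally show ?thesis .
  qed
  ultimately show ?thesis by simp
qed


text \<open>Boxes move one at a time from a column of length a + b - 1 to one of length 1 until the
  lengths are a and b. With the longer column named first, each move starts from a gap of at least
  two; symmetry supplies the other order.\<close>

lemma colsum_hook_step:
  assumes "1 \<le> a" "1 \<le> b" "a + b \<le> Suc N" "\<forall>c\<in>set cs. 1 \<le> c" "\<forall>i\<ge>2. t i = 0"
  shows "colsum N ((a + b - 1) # 1 # cs) t \<le> colsum N (a # b # cs) t"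
proof -
  have *: "colsum N ((a + b - 1) # 1 # cs) t \<le> colsum N (a # b # cs) t"
    if "1 \<le> b" "b \<le> a" "a + b \<le> Suc N" for a b
    using that
  proof (induction b arbitrary: a rule: nat_induct_at_least)
    case base
    then show ?case by simp
  next
    case (Suc b)
    have "colsum N ((Suc a + b - 1) # 1 # cs) t \<le> colsum N (Suc a # b # cs) t"
      using Suc by (intro Suc.IH) auto
    also have "\<dots> \<le> colsum N ((Suc a - 1) # (b + 1) # cs) t"
      using Suc assms by (intro colsum_balance_step) auto
    finally show ?case by (simp del: colsum.simps)
  qed
  show ?thesis
  proof (cases "b \<le> a")
    case True
    then show ?thesis using * assms by blast
  next
    case False
    then have "colsum N ((b + a - 1) # 1 # cs) t \<le> colsum N (b # a # cs) t"
      using assms by (intro *) auto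
    then show ?thesis by (simp only: colsum_swap add.commute)
  qed
qed

text \<open>Two columns are merged into a long one and one of length 1, and the remaining columns
  are treated by induction.\<close>

lemma colsum_ge_hook:
  assumes "\<forall>c\<in>set (c # cs). 1 \<le> c" "sum_list (c # cs) \<le> N" "\<forall>i\<ge>2. t i = 0"
  shows "colsum N ((sum_list (c # cs) - length cs) # replicate (length cs) 1) t \<le> colsum N (c # cs) t"
  using assms
proof (induction cs arbitrary: c t)
  case Nil
  then show ?case by simp
next
  case (Cons d cs)
  have "length cs \<le> sum_list cs"
    using Cons.prems by (induction cs) auto
  then have len: "c + d - 1 + sum_list cs - length cs = sum_list (c # d # cs) - length (d # cs)"
    using Cons.prems by simp
  \<comment> \<open>A column of length 1 is the factor x_1 - 1, so splitting it off amounts to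
    \<open>inc 0\<close>; this is why the induction runs over all \<open>t\<close>.\<close>
  have "colsum N ((sum_list ((c + d - 1) # cs) - length cs) # replicate (length cs) 1) (inc 0 t)
        \<le> colsum N ((c + d - 1) # cs) (inc 0 t)"
    by (rule Cons.IH) (use Cons.prems in \<open>auto simp: inc_def\<close>)
  then have "colsum N (1 # (c + d - 1 + sum_list cs - length cs) # replicate (length cs) 1) t
        \<le> colsum N (1 # (c + d - 1) # cs) t"
    by (simp add: colsum_Cons add.assoc del: colsum.simps)
  also have "\<dots> \<le> colsum N (c # d # cs) t"
    unfolding colsum_swap[of N 1]
    by (rule colsum_hook_step) (use Cons.prems in auto)
  finally show ?case
    unfolding len colsum_swap[of N 1] by simp
qed

text \<open>All entries are the minimum q or q + 1. The minimum occurs, so the number r of larger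
  entries is less than m, and n = q m + r is division with remainder. Balanced shapes are thereby
  unique.\<close>

lemma mset_balanced:
  fixes cs :: "nat list"
  assumes "cs \<noteq> []" "\<And>a b. a \<in> set cs \<Longrightarrow> b \<in> set cs \<Longrightarrow> a < b + 2"
    and "sum_list cs = n" "length cs = m"
  shows "mset cs = replicate_mset (n mod m) (n div m + 1) + replicate_mset (m - n mod m) (n div m)"
proof -
  define q where "q = Min (set cs)"
  define r where "r = length (filter (\<lambda>x. x \<noteq> q) cs)"
  have q: "q \<in> set cs" "\<And>x. x \<in> set cs \<Longrightarrow> q \<le> x"
    using assms(1) by (auto simp: q_def)
  have vals: "x = q \<or> x = q + 1" if "x \<in> set cs" for x
    using q(2)[OF that] assms(2)[OF that q(1)] by auto
  have ms: "mset cs = replicate_mset r (q + 1) + replicate_mset (m - r) q"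
  proof -
    have "mset cs = filter_mset (\<lambda>x. x \<noteq> q) (mset cs) + filter_mset (\<lambda>x. \<not> x \<noteq> q) (mset cs)"
      by (rule multiset_partition)
    moreover have "filter_mset (\<lambda>x. x \<noteq> q) (mset cs) = replicate_mset r (q + 1)"
      using vals unfolding r_def
      by (induction cs) auto
    moreover have "filter_mset (\<lambda>x. \<not> x \<noteq> q) (mset cs) = replicate_mset (m - r) q"
    proof -
      have "filter_mset (\<lambda>x. \<not> x \<noteq> q) (mset cs) = replicate_mset (count (mset cs) q) q"
        using filter_eq_replicate_mset[of q "mset cs"] by (simp add: eq_commute)
      moreover have "count (mset cs) q + r = m"
        unfolding r_def assms(4)[symmetric] by (induction cs) auto
      ultimately show ?thesis by (metis add_diff_cancel_right')
    qed
    ultimately show ?thesis by metis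
  qed
  have "r < m"
    unfolding r_def assms(4)[symmetric] using q(1) by (intro length_filter_less) auto
  moreover have "n = q * m + r"
  proof -
    have "n = sum_mset (mset cs)" using assms(3) by (simp add: sum_mset_sum_list)
    also have "\<dots> = r * (q + 1) + (m - r) * q" unfolding ms by simp
    also have "\<dots> = q * m + r" using \<open>r < m\<close>
      by (simp add: algebra_simps diff_mult_distrib)
    finally show ?thesis .
  qed
  ultimately have "n div m = q" "n mod m = r" by auto
  then show ?thesis using ms by simp
qed

text \<open>Balancing steps strictly lower the sum of the squares of the column lengths; once no
  step applies, \<open>mset_balanced\<close> identifies the result with \<open>ds\<close> up to
  order.\<close>

lemma colsum_le_balanced:
  assumes "\<forall>c\<in>set cs. 1 \<le> c" "sum_list cs \<le> N" "\<forall>i\<ge>2. t i = 0"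
    and "ds \<noteq> []" "length ds = length cs" "sum_list ds = sum_list cs"
    and "\<And>a b. a \<in> set ds \<Longrightarrow> b \<in> set ds \<Longrightarrow> a < b + 2"
  shows "colsum N cs t \<le> colsum N ds t"
  using assms
proof (induction "sum_list (map (\<lambda>c. c * c) cs)" arbitrary: cs rule: less_induct)
  case less
  show ?case
  proof (cases "\<forall>a\<in>set cs. \<forall>b\<in>set cs. a < b + 2")
    case True
    have "mset cs = mset ds"
    proof -
      have "cs \<noteq> []" using less.prems by auto
      then have "mset cs = replicate_mset (sum_list cs mod length cs) (sum_list cs div length cs + 1) +
          replicate_mset (length cs - sum_list cs mod length cs) (sum_list cs div length cs)"
        by (rule mset_balanced) (use True in auto)
      also have "\<dots> = mset ds"
        by (rule mset_balanced[symmetric]) (use less.prems in auto)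
      finally show ?thesis .
    qed
    then show ?thesis using colsum_mset by (metis order_refl)
  next
    case False
    then obtain a b where ab: "a \<in> set cs" "b \<in> set cs" "b + 2 \<le> a" by force
    define us where "us = remove1 a cs"
    have us: "mset cs = mset (a # us)" using ab(1) by (simp add: us_def)
    have "b \<in> set us" using ab mset_eq_setD[OF us] by auto
    define vs where "vs = remove1 b us"
    have "mset us = mset (b # vs)" using \<open>b \<in> set us\<close> by (simp add: vs_def)
    with us have cs: "mset cs = mset (a # b # vs)" by simp
    let ?ds = "(a - 1) # (b + 1) # vs"
    have sum: "sum_list (map f cs) = sum_list (map f (a # b # vs))" for f :: "nat \<Rightarrow> nat"
      unfolding sum_mset_sum_list[symmetric] mset_map cs ..
    have set: "set cs = set (a # b # vs)" by (rule mset_eq_setD[OF cs])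
    have len: "length cs = length (a # b # vs)" by (rule mset_eq_length[OF cs])
    have "colsum N cs t = colsum N (a # b # vs) t" by (rule colsum_mset[OF cs])
    also have "\<dots> \<le> colsum N ?ds t"
      using less.prems set ab(3) sum[of "\<lambda>x. x"] by (intro colsum_balance_step) auto
    also have "\<dots> \<le> colsum N ds t"
    proof (rule less.hyps)
      \<comment> \<open>The sum of squares drops by 2(a - b - 1), which is positive here; the
        substitution avoids truncated subtraction.\<close>
      obtain k where "a = b + 2 + k" using ab(3) le_Suc_ex by blast
      then show "sum_list (map (\<lambda>c. c * c) ?ds) < sum_list (map (\<lambda>c. c * c) cs)"
        unfolding sum by (simp add: algebra_simps)
    qed (use less.prems sum[of "\<lambda>x. x"] set len ab(3) in auto)
    finally show ?thesis .
  qed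
qed

section \<open>Class sums acting on left ideals of the group algebra\<close>

text \<open>The identity has trace equal to the dimension, which is nonzero because of
  \<open>v\<close>, and the sum of the operators is the scalar \<open>e\<close>, with trace
  \<open>e\<close> times the dimension. Of the basis picked by \<open>SOME\<close> only finiteness
  and the span matter.\<close>

lemma trace_on_class_sum:
  fixes L :: "'s \<Rightarrow> ('a \<Rightarrow> complex) \<Rightarrow> 'a \<Rightarrow> complex"
  assumes V: "V = cfun.span T" "finite T" and v: "v \<in> V" "v \<noteq> 0"
    and closed: "\<And>s v. s \<in> D \<Longrightarrow> v \<in> V \<Longrightarrow> L s v \<in> V"
    and scalar: "\<And>v. v \<in> V \<Longrightarrow> (\<Sum>s\<in>D. L s v) = (\<lambda>x. e * v x)"
    and one: "\<And>v. v \<in> V \<Longrightarrow> L i v = v"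
  shows "1 / trace_on V (L i) * (\<Sum>s\<in>D. trace_on V (L s)) = e"
proof -
  define B where "B = (SOME B. cfun.independent B \<and> cfun.span B = V)"
  have "\<exists>B. cfun.independent B \<and> cfun.span B = V"
  proof -
    obtain B where B: "B \<subseteq> V" "cfun.independent B" "V \<subseteq> cfun.span B"
      using cfun.maximal_independent_subset[of V] by blast
    moreover have "cfun.span B \<subseteq> V"
      unfolding V(1) using B(1) V(1) cfun.span_mono[of B V] cfun.span_span by metis
    ultimately show ?thesis by blast
  qed
  then have "cfun.independent B \<and> cfun.span B = V" unfolding B_def by (rule someI_ex)
  then have B: "cfun.independent B" "cfun.span B = V" by auto
  have B_sub: "b \<in> V" if "b \<in> B" for b using that B(2) cfun.span_base by blast
  have "finite B \<and> card B \<le> card T"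
    using cfun.independent_span_bound[OF V(2) B(1)] B_sub V(1) by blast
  then have "finite B" ..
  have "B \<noteq> {}" using v B(2) cfun.span_empty by force
  then have card: "card B \<noteq> 0" using \<open>finite B\<close> by simp
  have tr: "trace_on V f = (\<Sum>b\<in>B. cfun.representation B (f b) b)" for f
    by (simp add: trace_on_def B_def Let_def)
  have rep: "cfun.representation B b b = 1" if "b \<in> B" for b
    using cfun.representation_basis[OF B(1) that] by simp
  have "trace_on V (L i) = of_nat (card B)"
    unfolding tr using one B_sub rep by simp
  moreover have "(\<Sum>s\<in>D. trace_on V (L s)) = e * of_nat (card B)"
  proof -
    have "(\<Sum>s\<in>D. trace_on V (L s)) = (\<Sum>b\<in>B. \<Sum>s\<in>D. cfun.representation B (L s b) b)"
      unfolding tr by (rule sum.swap)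
    also have "\<dots> = (\<Sum>b\<in>B. e)"
    proof (rule sum.cong[OF refl])
      fix b assume b: "b \<in> B"
      have "(\<Sum>s\<in>D. cfun.representation B (L s b) b) = cfun.representation B (\<Sum>s\<in>D. L s b) b"
        using closed[OF _ B_sub[OF b]] B by (subst cfun.representation_sum) auto
      also have "\<dots> = e * cfun.representation B b b"
        unfolding scalar[OF B_sub[OF b]]
        using B b B_sub by (subst cfun.representation_scale) auto
      finally show "(\<Sum>s\<in>D. cfun.representation B (L s b) b) = e" using rep[OF b] by simp
    qed
    finally show ?thesis by simp
  qed
  ultimately show ?thesis using card by simp
qed

lemma sum_fun_apply: "(\<Sum>s\<in>D. f s) x = (\<Sum>s\<in>D. f s (x :: 'a) :: 'b :: comm_monoid_add)"
  by (induction D rule: infinite_finite_induct) auto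

lemma left_mult_add: "left_mult s (f + g) = left_mult s f + left_mult s g"
  and left_mult_scale: "left_mult s (\<lambda>x. a * f x) = (\<lambda>x. a * left_mult s f x)"
  and left_mult_zero: "left_mult s 0 = 0"
  by (auto simp: left_mult_def fun_eq_iff)

text \<open>Entries sit in distinct boxes, and each column is filled without gaps above any of its
  boxes; rows are counted from 0. In this form the group algebra argument is separated from the
  arithmetic of prefix sums of a partition.\<close>

locale tableau =
  fixes n :: nat and r c :: "nat \<Rightarrow> nat"
  assumes box_inj: "k \<in> {1..n} \<Longrightarrow> l \<in> {1..n} \<Longrightarrow> r k = r l \<Longrightarrow> c k = c l \<Longrightarrow> k = l"
    and box_above: "k \<in> {1..n} \<Longrightarrow> i < r k \<Longrightarrow> \<exists>l\<in>{1..n}. r l = i \<and> c l = c k"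
begin

definition rows :: "(nat \<Rightarrow> nat) set" where
  "rows = {p \<in> sym_group n. \<forall>k\<in>{1..n}. r (p k) = r k}"

definition cols :: "(nat \<Rightarrow> nat) set" where
  "cols = {q \<in> sym_group n. \<forall>k\<in>{1..n}. c (q k) = c k}"

definition symmetrizer :: group_algebra where
  "symmetrizer = (\<lambda>x. \<Sum>p\<in>rows. \<Sum>q\<in>cols. if x = p \<circ> q then of_int (sign q) else 0)"

section \<open>Row and column permutations\<close>

lemma sym_group_comp: "p \<in> sym_group n \<Longrightarrow> q \<in> sym_group n \<Longrightarrow> p \<circ> q \<in> sym_group n"
  by (auto simp: sym_group_def permutes_compose)

lemma sym_group_inv: "p \<in> sym_group n \<Longrightarrow> inv p \<in> sym_group n"
  unfolding sym_group_def using permutes_inv by blast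

lemma sym_group_in: "p \<in> sym_group n \<Longrightarrow> p k \<in> {1..n} \<longleftrightarrow> k \<in> {1..n}"
  using permutes_in_image[of p "{1..n}" k] by (simp add: sym_group_def)

lemma sym_group_inv_apply [simp]: "p \<in> sym_group n \<Longrightarrow> p (inv p k) = k" "p \<in> sym_group n \<Longrightarrow> inv p (p k) = k"
  by (auto simp: sym_group_def permutes_inverses)

lemma finite_sym_group: "finite (sym_group n)"
  by (simp add: sym_group_def finite_permutations)

lemma sym_group_sign: "p \<in> sym_group n \<Longrightarrow> q \<in> sym_group n \<Longrightarrow> sign (p \<circ> q) = sign p * sign q"
  unfolding sym_group_def
  by (auto intro!: sign_compose permutes_imp_permutation[of "{1..n}"])

lemma rows_sym: "p \<in> rows \<Longrightarrow> p \<in> sym_group n" by (simp add: rows_def)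
lemma cols_sym: "p \<in> cols \<Longrightarrow> p \<in> sym_group n" by (simp add: cols_def)

lemma finite_rows: "finite rows" and finite_cols: "finite cols"
  by (rule finite_subset[OF _ finite_sym_group], auto simp: rows_def cols_def)+

lemma id_rows: "id \<in> rows" and id_cols: "id \<in> cols"
  by (auto simp: rows_def cols_def sym_group_def)

lemma sym_group_closed: "p \<in> sym_group n \<Longrightarrow> k \<in> {1..n} \<Longrightarrow> p k \<in> {1..n}"
  by (simp only: sym_group_in)

lemma row_eq: "p \<in> rows \<Longrightarrow> k \<in> {1..n} \<Longrightarrow> r (p k) = r k"
  by (simp add: rows_def)

lemma col_eq: "q \<in> cols \<Longrightarrow> k \<in> {1..n} \<Longrightarrow> c (q k) = c k"
  by (simp add: cols_def)

lemma rows_comp: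
  assumes "p \<in> rows" "q \<in> rows" shows "p \<circ> q \<in> rows"
  unfolding rows_def
proof (intro CollectI conjI ballI)
  show "p \<circ> q \<in> sym_group n" using assms by (intro sym_group_comp rows_sym)
  fix k assume k: "k \<in> {1..n}"
  have "q k \<in> {1..n}" by (rule sym_group_closed[OF rows_sym[OF assms(2)] k])
  then show "r ((p \<circ> q) k) = r k"
    using row_eq[OF assms(1)] row_eq[OF assms(2) k] by simp
qed

lemma cols_comp:
  assumes "p \<in> cols" "q \<in> cols" shows "p \<circ> q \<in> cols"
  unfolding cols_def
proof (intro CollectI conjI ballI)
  show "p \<circ> q \<in> sym_group n" using assms by (intro sym_group_comp cols_sym)
  fix k assume k: "k \<in> {1..n}"
  have "q k \<in> {1..n}" by (rule sym_group_closed[OF cols_sym[OF assms(2)] k])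
  then show "c ((p \<circ> q) k) = c k"
    using col_eq[OF assms(1)] col_eq[OF assms(2) k] by simp
qed

lemma rows_inv:
  assumes "p \<in> rows" shows "inv p \<in> rows"
  unfolding rows_def
proof (intro CollectI conjI ballI)
  show p: "inv p \<in> sym_group n" using assms by (intro sym_group_inv rows_sym)
  fix k assume k: "k \<in> {1..n}"
  show "r (inv p k) = r k"
    using row_eq[OF assms sym_group_closed[OF p k]] rows_sym[OF assms] by simp
qed

lemma cols_inv:
  assumes "p \<in> cols" shows "inv p \<in> cols"
  unfolding cols_def
proof (intro CollectI conjI ballI)
  show p: "inv p \<in> sym_group n" using assms by (intro sym_group_inv cols_sym)
  fix k assume k: "k \<in> {1..n}"
  show "c (inv p k) = c k"
    using col_eq[OF assms sym_group_closed[OF p k]] cols_sym[OF assms] by simp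
qed

lemma outside: "p \<in> sym_group n \<Longrightarrow> k \<notin> {1..n} \<Longrightarrow> p k = k"
  using permutes_not_in[of p "{1..n}" k] by (simp add: sym_group_def)

text \<open>The box of \<open>q k\<close> is known: its column is that of \<open>k\<close> and its
  row is that of \<open>p (q k)\<close>.\<close>

lemma rows_cols_unique:
  assumes "p \<in> rows" "q \<in> cols" "p' \<in> rows" "q' \<in> cols" "p \<circ> q = p' \<circ> q'"
  shows "p = p' \<and> q = q'"
proof -
  have "q k = q' k" for k
  proof (cases "k \<in> {1..n}")
    case True
    have in_X: "q k \<in> {1..n}" "q' k \<in> {1..n}"
      using sym_group_closed[OF cols_sym True] assms by blast+
    have "r (q k) = r (p (q k))" using row_eq[OF assms(1) in_X(1)] by simp
    also have "p (q k) = p' (q' k)" using assms(5) by (metis comp_apply)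
    also have "r \<dots> = r (q' k)" using row_eq[OF assms(3) in_X(2)] by simp
    finally show ?thesis
      using box_inj[OF in_X] col_eq[OF assms(2) True] col_eq[OF assms(4) True] by simp
  next
    case False
    then show ?thesis using outside assms cols_sym by metis
  qed
  then have q: "q = q'" by auto
  have "p k = p' k" for k
  proof -
    have "p (q (inv q k)) = p' (q' (inv q k))" using assms(5) by (metis comp_apply)
    then show ?thesis using q cols_sym[OF assms(2)] by simp
  qed
  then show ?thesis using q by auto
qed

text \<open>If \<open>p (q k) = k\<close>, then \<open>q k\<close> shares both row and column with
  \<open>k\<close>. This splits the fixed-point condition into separate conditions on
  \<open>p\<close> and \<open>q\<close>, as inclusion-exclusion requires.\<close>

lemma rows_cols_fixed:
  assumes "p \<in> rows" "q \<in> cols" "k \<in> {1..n}"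
  shows "p (q k) = k \<longleftrightarrow> p k = k \<and> q k = k"
proof
  assume *: "p (q k) = k"
  have in_X: "q k \<in> {1..n}" by (rule sym_group_closed[OF cols_sym[OF assms(2)] assms(3)])
  have "q k = k"
    using row_eq[OF assms(1) in_X] col_eq[OF assms(2,3)] * by (intro box_inj[OF in_X assms(3)]) auto
  with * show "p k = k \<and> q k = k" by simp
qed auto

text \<open>
  Summed over all columns \<open>j\<close>, both sides of the next inequality count the boxes in the first \<open>i\<close> rows,
  so equality holds in every column.
\<close>

lemma card_top_rows_le:
  assumes x: "x \<in> sym_group n"
    and distinct: "\<And>k l. k \<in> {1..n} \<Longrightarrow> l \<in> {1..n} \<Longrightarrow> k \<noteq> l \<Longrightarrow> c k = c l \<Longrightarrow> r (x k) \<noteq> r (x l)"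
  shows "card {k\<in>{1..n}. c k = j \<and> r (x k) < i} \<le> card {k\<in>{1..n}. c k = j \<and> r k < i}"
proof (cases "\<exists>k\<in>{1..n}. c k = j \<and> i \<le> r k")
  \<comment> \<open>A column reaching row \<open>i\<close> has a box in every earlier row, so the
    right side is at least \<open>i\<close>; the left side is at most \<open>i\<close> because
    \<open>r \<circ> x\<close> is injective on the column.\<close>
  case True
  then obtain k where k: "k \<in> {1..n}" "c k = j" "i \<le> r k" by blast
  have "card {k\<in>{1..n}. c k = j \<and> r (x k) < i} \<le> card {..<i}"
  proof (rule card_inj_on_le[of "r \<circ> x"])
    show "inj_on (r \<circ> x) {k\<in>{1..n}. c k = j \<and> r (x k) < i}"
      by (rule inj_onI, rule ccontr) (use distinct in auto)
  qed auto
  also have "\<dots> \<le> card (r ` {k\<in>{1..n}. c k = j \<and> r k < i})"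
  proof (rule card_mono)
    show "{..<i} \<subseteq> r ` {k\<in>{1..n}. c k = j \<and> r k < i}"
    proof
      fix i' assume "i' \<in> {..<i}"
      then show "i' \<in> r ` {k\<in>{1..n}. c k = j \<and> r k < i}"
        using box_above[OF k(1), of i'] k by force
    qed
  qed auto
  also have "\<dots> \<le> card {k\<in>{1..n}. c k = j \<and> r k < i}" by (rule card_image_le) auto
  finally show ?thesis .
next
  case False
  then show ?thesis by (intro card_mono) force+
qed

text \<open>The column permutation must send \<open>k\<close> to the box in the column of
  \<open>k\<close> and the row of \<open>x k\<close>. Counting shows that this box exists, and
  distinctness makes the map injective; what remains of \<open>x\<close> preserves rows.\<close>

lemma rows_cols_decomp:
  assumes x: "x \<in> sym_group n"
    and distinct: "\<And>k l. k \<in> {1..n} \<Longrightarrow> l \<in> {1..n} \<Longrightarrow> k \<noteq> l \<Longrightarrow> c k = c l \<Longrightarrow> r (x k) \<noteq> r (x l)"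
  shows "\<exists>p\<in>rows. \<exists>q\<in>cols. x = p \<circ> q"
proof -
  let ?X = "{1..n}"
  have total: "(\<Sum>j\<in>c ` ?X. card {k\<in>?X. c k = j \<and> P k}) = card {k\<in>?X. P k}" for P :: "nat \<Rightarrow> bool"
  proof -
    have "card {k\<in>?X. P k} = card (\<Union>j\<in>c ` ?X. {k\<in>?X. c k = j \<and> P k})"
      by (rule arg_cong[of _ _ card]) auto
    also have "\<dots> = (\<Sum>j\<in>c ` ?X. card {k\<in>?X. c k = j \<and> P k})"
      by (rule card_UN_disjoint) auto
    finally show ?thesis by simp
  qed
  have eq: "card {k\<in>?X. c k = j \<and> r (x k) < i} = card {k\<in>?X. c k = j \<and> r k < i}"
    if "j \<in> c ` ?X" for i j
  proof -
    have "bij_betw x {k\<in>?X. r (x k) < i} {k\<in>?X. r k < i}"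
    proof (rule bij_betw_byWitness[of _ "inv x"])
      show "x ` {k\<in>?X. r (x k) < i} \<subseteq> {k\<in>?X. r k < i}"
        using sym_group_closed[OF x] by (simp add: image_subset_iff)
      show "inv x ` {k\<in>?X. r k < i} \<subseteq> {k\<in>?X. r (x k) < i}"
        using sym_group_closed[OF sym_group_inv[OF x]] x by (simp add: image_subset_iff)
    qed (use x in auto)
    then have "(\<Sum>j\<in>c ` ?X. card {k\<in>?X. c k = j \<and> r (x k) < i}) =
               (\<Sum>j\<in>c ` ?X. card {k\<in>?X. c k = j \<and> r k < i})"
      unfolding total by (rule bij_betw_same_card)
    moreover have "card {k\<in>?X. c k = j \<and> r (x k) < i} \<le> card {k\<in>?X. c k = j \<and> r k < i}" for j
      by (rule card_top_rows_le[OF x distinct])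
    ultimately show ?thesis
      using sum_mono_inv[of "\<lambda>j. card {k\<in>?X. c k = j \<and> r (x k) < i}" "c ` ?X"
          "\<lambda>j. card {k\<in>?X. c k = j \<and> r k < i}" j] that by blast
  qed
  \<comment> \<open>With \<open>h\<close> the last row of the column, the equality of counts at
    \<open>Suc h\<close> says that \<open>x\<close> sends the entries of the column to rows up to
    \<open>h\<close>, all of which the column meets.\<close>
  have ex: "\<exists>l. l \<in> ?X \<and> c l = c k \<and> r l = r (x k)" if k: "k \<in> ?X" for k
  proof -
    define h where "h = Max (r ` {l\<in>?X. c l = c k})"
    have "h \<in> r ` {l\<in>?X. c l = c k}"
      unfolding h_def using k by (intro Max_in) auto
    then obtain m where m: "m \<in> ?X" "c m = c k" "r m = h" by auto
    have le: "r l \<le> h" if "l \<in> ?X" "c l = c k" for l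
      unfolding h_def using that by (intro Max_ge) auto
    have "{l\<in>?X. c l = c k \<and> r (x l) < Suc h} = {l\<in>?X. c l = c k}"
    proof (rule card_subset_eq)
      have "{l\<in>?X. c l = c k \<and> r l < Suc h} = {l\<in>?X. c l = c k}"
        using le by (auto simp: less_Suc_eq_le)
      then show "card {l\<in>?X. c l = c k \<and> r (x l) < Suc h} = card {l\<in>?X. c l = c k}"
        using eq[of "c k" "Suc h"] k by simp
    qed auto
    then have "k \<in> {l\<in>?X. c l = c k \<and> r (x l) < Suc h}" using k by blast
    then have "r (x k) \<le> h" by simp
    then show ?thesis using m box_above[OF m(1), of "r (x k)"] by (cases "r (x k) = h") auto
  qed
  then obtain f where f: "\<And>k. k \<in> ?X \<Longrightarrow> f k \<in> ?X \<and> c (f k) = c k \<and> r (f k) = r (x k)"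
    by metis
  define q where "q = (\<lambda>k. if k \<in> ?X then f k else k)"
  have "inj_on q ?X"
    unfolding inj_on_def q_def using f distinct by auto metis
  moreover have "q ` ?X \<subseteq> ?X" using f by (auto simp: q_def)
  ultimately have "bij_betw q ?X ?X"
    unfolding bij_betw_def using endo_inj_surj[of ?X q] by auto
  then have q_perm: "q permutes ?X"
    by (intro bij_imp_permutes) (auto simp: q_def)
  then have q: "q \<in> cols" using f by (auto simp: cols_def sym_group_def q_def)
  have "x \<circ> inv q \<in> rows"
    unfolding rows_def
  proof (intro CollectI conjI ballI)
    show "x \<circ> inv q \<in> sym_group n" using x q by (auto intro: sym_group_comp sym_group_inv cols_sym)
    fix k assume k: "k \<in> ?X"
    let ?l = "inv q k"
    have l: "?l \<in> ?X" "q ?l = k"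
      using sym_group_closed[OF sym_group_inv[OF cols_sym[OF q]] k] cols_sym[OF q] by simp_all
    have "r (x ?l) = r (q ?l)" using f l(1) by (simp add: q_def)
    then show "r ((x \<circ> inv q) k) = r k" using l by simp
  qed
  moreover have "x = (x \<circ> inv q) \<circ> q" using cols_sym[OF q] by (auto simp: fun_eq_iff)
  ultimately show ?thesis using q by blast
qed

section \<open>The Young symmetrizer and von Neumann's lemma\<close>

lemma symmetrizer_rows_cols: "p \<in> rows \<Longrightarrow> q \<in> cols \<Longrightarrow> symmetrizer (p \<circ> q) = of_int (sign q)"
proof -
  assume pq: "p \<in> rows" "q \<in> cols"
  have "symmetrizer (p \<circ> q) = (\<Sum>p'\<in>rows. \<Sum>q'\<in>cols. if p' = p \<and> q' = q then of_int (sign q) else 0)"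
    unfolding symmetrizer_def using rows_cols_unique[OF pq] by (intro sum.cong refl) auto
  also have "\<dots> = (\<Sum>p'\<in>rows. if p' = p then of_int (sign q) else 0)"
    using pq finite_cols by (intro sum.cong refl) auto
  finally show ?thesis using pq finite_rows by simp
qed

lemma symmetrizer_eq_0: "\<not> (\<exists>p\<in>rows. \<exists>q\<in>cols. x = p \<circ> q) \<Longrightarrow> symmetrizer x = 0"
  unfolding symmetrizer_def by (intro sum.neutral ballI) auto

lemma symmetrizer_id: "symmetrizer id = 1"
  using symmetrizer_rows_cols[OF id_rows id_cols] by simp

lemma symmetrizer_row: "p \<in> rows \<Longrightarrow> x \<in> sym_group n \<Longrightarrow> symmetrizer (p \<circ> x) = symmetrizer x"
proof (cases "\<exists>p\<in>rows. \<exists>q\<in>cols. x = p \<circ> q")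
  case True
  assume p: "p \<in> rows"
  obtain p' q where x: "p' \<in> rows" "q \<in> cols" "x = p' \<circ> q" using True by blast
  have "symmetrizer ((p \<circ> p') \<circ> q) = of_int (sign q)"
    by (rule symmetrizer_rows_cols[OF rows_comp[OF p x(1)] x(2)])
  then show ?thesis unfolding x(3) comp_assoc symmetrizer_rows_cols[OF x(1,2)] .
next
  case False
  assume p: "p \<in> rows"
  have "\<not> (\<exists>p'\<in>rows. \<exists>q\<in>cols. p \<circ> x = p' \<circ> q)"
  proof safe
    fix p' q assume *: "p' \<in> rows" "q \<in> cols" "p \<circ> x = p' \<circ> q"
    have "x = inv p \<circ> (p \<circ> x)" using rows_sym[OF p] by (auto simp: fun_eq_iff)
    also have "\<dots> = (inv p \<circ> p') \<circ> q" using * by (simp add: comp_assoc)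
    finally show False using False * rows_comp rows_inv p by blast
  qed
  then show ?thesis using False by (simp add: symmetrizer_eq_0)
qed

lemma symmetrizer_col: "q \<in> cols \<Longrightarrow> x \<in> sym_group n \<Longrightarrow> symmetrizer (x \<circ> q) = of_int (sign q) * symmetrizer x"
proof (cases "\<exists>p\<in>rows. \<exists>q\<in>cols. x = p \<circ> q")
  case True
  assume q: "q \<in> cols"
  obtain p q' where x: "p \<in> rows" "q' \<in> cols" "x = p \<circ> q'" using True by blast
  have "symmetrizer (p \<circ> (q' \<circ> q)) = of_int (sign (q' \<circ> q))"
    by (rule symmetrizer_rows_cols[OF x(1) cols_comp[OF x(2) q]])
  also have "sign (q' \<circ> q) = sign q' * sign q"
    by (rule sym_group_sign) (use x q cols_sym in auto)
  finally show ?thesis unfolding x(3) comp_assoc symmetrizer_rows_cols[OF x(1,2)] by (simp only: of_int_mult mult.commute)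
next
  case False
  assume q: "q \<in> cols"
  have "\<not> (\<exists>p\<in>rows. \<exists>q'\<in>cols. x \<circ> q = p \<circ> q')"
  proof safe
    fix p q' assume *: "p \<in> rows" "q' \<in> cols" "x \<circ> q = p \<circ> q'"
    have "x = x \<circ> q \<circ> inv q" using cols_sym[OF q] by (auto simp: fun_eq_iff)
    also have "\<dots> = p \<circ> (q' \<circ> inv q)" using * by (simp add: comp_assoc)
    finally show False using False * cols_comp cols_inv q by blast
  qed
  then show ?thesis using False by (simp add: symmetrizer_eq_0)
qed

text \<open>On products of row and column permutations the two symmetries determine \<open>f\<close>
  from \<open>f id\<close>. Any other \<open>x\<close> sends two entries of one column to one row;
  swapping them before \<open>x\<close> is the same as swapping their images after it, so f x = - f
  x.\<close>

lemma von_neumann: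
  fixes f :: group_algebra
  assumes f_row: "\<And>p x. p \<in> rows \<Longrightarrow> x \<in> sym_group n \<Longrightarrow> f (p \<circ> x) = f x"
    and f_col: "\<And>q x. q \<in> cols \<Longrightarrow> x \<in> sym_group n \<Longrightarrow> f (x \<circ> q) = of_int (sign q) * f x"
    and x: "x \<in> sym_group n"
  shows "f x = f id * symmetrizer x"
proof (cases "\<exists>p\<in>rows. \<exists>q\<in>cols. x = p \<circ> q")
  case True
  then obtain p q where pq: "p \<in> rows" "q \<in> cols" "x = p \<circ> q" by blast
  have "f x = f (id \<circ> q)" using f_row pq cols_sym by simp
  also have "\<dots> = of_int (sign q) * f id" using id_rows rows_sym by (intro f_col pq) auto
  finally show ?thesis using pq symmetrizer_rows_cols by simp
next
  case False
  then obtain k l where kl: "k \<in> {1..n}" "l \<in> {1..n}" "k \<noteq> l" "c k = c l" "r (x k) = r (x l)"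
    using rows_cols_decomp[OF x] by blast
  let ?q = "transpose k l" and ?p = "transpose (x k) (x l)"
  have q: "?q \<in> cols"
    using kl by (auto simp: cols_def sym_group_def permutes_swap_id Transposition.transpose_def)
  have "x k \<in> {1..n}" "x l \<in> {1..n}" using kl sym_group_closed[OF x] by simp_all
  then have p: "?p \<in> rows"
    using kl by (auto simp: rows_def sym_group_def permutes_swap_id Transposition.transpose_def)
  have "inj x" using x by (auto simp: sym_group_def permutes_inj)
  then have "?p \<circ> x = x \<circ> ?q"
    by (auto simp: fun_eq_iff Transposition.transpose_def inj_eq)
  then have "f x = f (x \<circ> ?q)" using f_row[OF p x] by metis
  also have "\<dots> = - f x" using f_col[OF q x] kl by (simp add: sign_swap_id)
  finally have "f x = 0" by simp
  then show ?thesis using symmetrizer_eq_0[OF False] by simp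
qed

section \<open>The class sum of the derangements is central\<close>

lemma sym_group_bij: "p \<in> sym_group n \<Longrightarrow> bij p"
  by (auto simp: sym_group_def intro: permutes_bij)

lemma sym_group_inv_distrib:
  "p \<in> sym_group n \<Longrightarrow> q \<in> sym_group n \<Longrightarrow> inv (p \<circ> q) = inv q \<circ> inv p"
  by (intro o_inv_distrib sym_group_bij)

lemma sym_group_inv_inv: "p \<in> sym_group n \<Longrightarrow> inv (inv p) = p"
  by (intro inv_inv_eq sym_group_bij)

lemma left_mult_comp:
  "s \<in> sym_group n \<Longrightarrow> t \<in> sym_group n \<Longrightarrow> left_mult s (left_mult t f) = left_mult (s \<circ> t) f"
  by (simp add: left_mult_def sym_group_inv_distrib comp_assoc)

text \<open>Elements of \<open>group_algebra\<close> are functions on all maps, so the values off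
  the symmetric group have to be controlled as well.\<close>

lemma symmetrizer_outside: "x \<notin> sym_group n \<Longrightarrow> symmetrizer x = 0"
  using symmetrizer_eq_0 sym_group_comp rows_sym cols_sym by metis

lemma derangements_sym: "s \<in> derangements n \<Longrightarrow> s \<in> sym_group n"
  by (simp add: derangements_def)

lemma derangements_conj:
  assumes "t \<in> sym_group n" "s \<in> derangements n"
  shows "t \<circ> s \<circ> inv t \<in> derangements n"
  unfolding derangements_def
proof (intro CollectI conjI ballI)
  show "t \<circ> s \<circ> inv t \<in> sym_group n"
    by (rule sym_group_comp[OF sym_group_comp[OF assms(1) derangements_sym[OF assms(2)]]
          sym_group_inv[OF assms(1)]])
  fix i assume "i \<in> {1..n}"
  then have "inv t i \<in> {1..n}" by (intro sym_group_closed[OF sym_group_inv[OF assms(1)]])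
  then have "s (inv t i) \<noteq> inv t i" using assms(2) by (simp add: derangements_def)
  moreover have "inv t (t (s (inv t i))) = s (inv t i)" using assms(1) by simp
  ultimately show "(t \<circ> s \<circ> inv t) i \<noteq> i" by (metis comp_apply)
qed

text \<open>Centrality of the class sum, in the form of a change of the summation variable.\<close>

lemma sum_derangements_conj:
  assumes t: "t \<in> sym_group n"
  shows "(\<Sum>s\<in>derangements n. g (t \<circ> s \<circ> inv t)) = (\<Sum>s\<in>derangements n. g s)"
proof (rule sum.reindex_bij_witness[of _ "\<lambda>s. inv t \<circ> s \<circ> t" "\<lambda>s. t \<circ> s \<circ> inv t"])
  fix s assume s: "s \<in> derangements n"
  show "t \<circ> s \<circ> inv t \<in> derangements n" by (rule derangements_conj[OF t s])
  show "inv t \<circ> s \<circ> t \<in> derangements n"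
    using derangements_conj[OF sym_group_inv[OF t] s] sym_group_inv_inv[OF t] by simp
qed (use t in \<open>auto simp: fun_eq_iff\<close>)

lemma sum_derangements_inv:
  "(\<Sum>s\<in>derangements n. g (inv s)) = (\<Sum>s\<in>derangements n. g s)"
proof -
  have *: "inv s \<in> derangements n" if s: "s \<in> derangements n" for s
    unfolding derangements_def
  proof (intro CollectI conjI ballI)
    show "inv s \<in> sym_group n" by (intro sym_group_inv derangements_sym s)
    fix i assume "i \<in> {1..n}"
    then have "s i \<noteq> i" using s by (simp add: derangements_def)
    then show "inv s i \<noteq> i" using sym_group_inv_apply(1)[OF derangements_sym[OF s]] by metis
  qed
  show ?thesis
    by (rule sum.reindex_bij_witness[of _ inv inv]) (use * derangements_sym sym_group_inv_inv in auto)
qed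

text \<open>The coefficient at \<open>id\<close> of the class sum times the symmetrizer, written out
  over pairs of row and column permutations.\<close>

definition eigenvalue :: complex where
  "eigenvalue = (\<Sum>p\<in>rows. \<Sum>q\<in>cols. if p \<circ> q \<in> derangements n then of_int (sign q) else 0)"

lemma eigenvalue_eq: "eigenvalue = (\<Sum>s\<in>derangements n. symmetrizer (inv s))"
proof -
  have fin: "finite (derangements n)"
    by (rule finite_subset[OF _ finite_sym_group]) (auto simp: derangements_def)
  have "(\<Sum>s\<in>derangements n. symmetrizer (inv s)) = (\<Sum>s\<in>derangements n. symmetrizer s)"
    by (rule sum_derangements_inv)
  also have "\<dots> = (\<Sum>p\<in>rows. \<Sum>s\<in>derangements n. \<Sum>q\<in>cols. if s = p \<circ> q then of_int (sign q) else 0)"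
    unfolding symmetrizer_def by (rule sum.swap)
  also have "\<dots> = (\<Sum>p\<in>rows. \<Sum>q\<in>cols. \<Sum>s\<in>derangements n. if s = p \<circ> q then of_int (sign q) else 0)"
    by (rule sum.cong[OF refl], rule sum.swap)
  also have "\<dots> = eigenvalue"
    unfolding eigenvalue_def using fin by simp
  finally show ?thesis ..
qed

text \<open>As a function of \<open>x\<close> the left side is invariant under row permutations by
  centrality and alternating under column permutations, so \<open>von_neumann\<close> applies, with
  factor \<open>eigenvalue\<close> by \<open>eigenvalue_eq\<close>. Off the symmetric group both
  sides vanish.\<close>

lemma derangement_sum_symmetrizer:
  "(\<Sum>s\<in>derangements n. symmetrizer (inv s \<circ> x)) = eigenvalue * symmetrizer x"
proof (cases "x \<in> sym_group n")
  case True
  define f where "f = (\<lambda>x. \<Sum>s\<in>derangements n. symmetrizer (inv s \<circ> x))"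
  have "f x = f id * symmetrizer x"
  proof (rule von_neumann[OF _ _ True])
    fix p x assume p: "p \<in> rows" and x: "x \<in> sym_group n"
    note p' = rows_sym[OF p]
    have "f (p \<circ> x) = (\<Sum>s\<in>derangements n. symmetrizer (inv (p \<circ> s \<circ> inv p) \<circ> (p \<circ> x)))"
      unfolding f_def by (rule sum_derangements_conj[OF p', symmetric])
    also have "\<dots> = f x"
      unfolding f_def
    proof (rule sum.cong[OF refl])
      fix s assume "s \<in> derangements n"
      then have s: "s \<in> sym_group n" by (rule derangements_sym)
      have "inv (p \<circ> s \<circ> inv p) = p \<circ> (inv s \<circ> inv p)"
        using p' s by (simp add: sym_group_inv_distrib sym_group_comp sym_group_inv sym_group_inv_inv)
      then have "inv (p \<circ> s \<circ> inv p) \<circ> (p \<circ> x) = p \<circ> (inv s \<circ> x)"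
        using p' by (simp add: fun_eq_iff)
      then show "symmetrizer (inv (p \<circ> s \<circ> inv p) \<circ> (p \<circ> x)) = symmetrizer (inv s \<circ> x)"
        using symmetrizer_row[OF p sym_group_comp[OF sym_group_inv[OF s] x]] by simp
    qed
    finally show "f (p \<circ> x) = f x" .
  next
    fix q x assume q: "q \<in> cols" and x: "x \<in> sym_group n"
    show "f (x \<circ> q) = of_int (sign q) * f x"
      unfolding f_def sum_distrib_left
    proof (rule sum.cong[OF refl])
      fix s assume "s \<in> derangements n"
      then have "inv s \<circ> x \<in> sym_group n"
        by (intro sym_group_comp sym_group_inv derangements_sym x)
      from symmetrizer_col[OF q this]
      show "symmetrizer (inv s \<circ> (x \<circ> q)) = of_int (sign q) * symmetrizer (inv s \<circ> x)"
        by (simp only: comp_assoc)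
    qed
  qed
  then show ?thesis by (simp add: f_def eigenvalue_eq)
next
  case False
  have "inv s \<circ> x \<notin> sym_group n" if "s \<in> derangements n" for s
  proof
    assume "inv s \<circ> x \<in> sym_group n"
    then have "s \<circ> (inv s \<circ> x) \<in> sym_group n"
      by (rule sym_group_comp[OF derangements_sym[OF that]])
    moreover have "s \<circ> (inv s \<circ> x) = x" using derangements_sym[OF that] by (auto simp: fun_eq_iff)
    ultimately show False using False by simp
  qed
  then show ?thesis using False by (simp add: symmetrizer_outside)
qed

section \<open>The scalar action on the irreducible representation\<close>

definition irrep :: "group_algebra set" where
  "irrep = cfun.span ((\<lambda>s. left_mult s symmetrizer) ` sym_group n)"

lemma irrep_left_mult:
  assumes s: "s \<in> sym_group n" and v: "v \<in> irrep"
  shows "left_mult s v \<in> irrep"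
  using v unfolding irrep_def
proof (induction rule: cfun.span_induct)
  case base
  show ?case
    by (auto simp: cfun.subspace_def left_mult_add left_mult_scale left_mult_zero
        intro: cfun.span_zero cfun.span_add cfun.span_scale)
next
  case (step x)
  then show ?case using s
    by (auto simp: left_mult_comp sym_group_comp intro!: cfun.span_base)
qed

text \<open>The scalar is known on the symmetrizer; centrality carries it to the translates,
  linearity to their span.\<close>

lemma derangement_sum_irrep:
  assumes v: "v \<in> irrep"
  shows "(\<Sum>s\<in>derangements n. left_mult s v) = (\<lambda>x. eigenvalue * v x)"
  using v unfolding irrep_def
proof (induction rule: cfun.span_induct)
  case base
  show ?case
    by (auto simp: cfun.subspace_def left_mult_add left_mult_scale left_mult_zero fun_eq_iff
        sum_fun_apply sum.distrib sum_distrib_left algebra_simps simp flip: sum_distrib_left)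
next
  case (step v)
  then obtain t where t: "t \<in> sym_group n" and v: "v = left_mult t symmetrizer" by auto
  show ?case
  proof
    fix x
    have "(\<Sum>s\<in>derangements n. left_mult s v) x = (\<Sum>s\<in>derangements n. left_mult s v x)"
      by (rule sum_fun_apply)
    also have "\<dots> = (\<Sum>s\<in>derangements n. left_mult (t \<circ> s \<circ> inv t) v x)"
      by (rule sum_derangements_conj[OF t, symmetric])
    also have "\<dots> = (\<Sum>s\<in>derangements n. symmetrizer (inv s \<circ> (inv t \<circ> x)))"
    proof (rule sum.cong[OF refl])
      fix s assume "s \<in> derangements n"
      then have s: "s \<in> sym_group n" by (rule derangements_sym)
      have "t \<circ> s \<circ> inv t \<circ> t = t \<circ> s" using t by (auto simp: fun_eq_iff)
      then show "left_mult (t \<circ> s \<circ> inv t) v x = symmetrizer (inv s \<circ> (inv t \<circ> x))"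
        unfolding v using s t
        by (simp add: left_mult_comp sym_group_comp sym_group_inv)
           (simp add: left_mult_def sym_group_inv_distrib comp_assoc)
    qed
    also have "\<dots> = eigenvalue * v x"
      unfolding derangement_sum_symmetrizer by (simp add: v left_mult_def)
    finally show "(\<Sum>s\<in>derangements n. left_mult s v) x = eigenvalue * v x" .
  qed
qed

text \<open>The left side has the shape of \<open>eta\<close>. The symmetrizer witnesses positive
  dimension, since its coefficient at \<open>id\<close> is 1.\<close>

lemma trace_eq_eigenvalue:
  "1 / trace_on irrep (left_mult id) * (\<Sum>s\<in>derangements n. trace_on irrep (left_mult s)) = eigenvalue"
proof (rule trace_on_class_sum[OF irrep_def, of symmetrizer])
  show "finite ((\<lambda>s. left_mult s symmetrizer) ` sym_group n)" using finite_sym_group by simp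
  have "left_mult id symmetrizer \<in> irrep"
    unfolding irrep_def by (intro cfun.span_base imageI rows_sym id_rows)
  then show "symmetrizer \<in> irrep" by (simp add: left_mult_def)
  show "symmetrizer \<noteq> 0" using symmetrizer_id by (metis zero_fun_apply zero_neq_one)
  show "left_mult s v \<in> irrep" if "s \<in> derangements n" "v \<in> irrep" for s v
    using that by (intro irrep_left_mult derangements_sym)
  show "left_mult id v = v" for v
    by (simp add: left_mult_def flip: id_def)
qed (rule derangement_sum_irrep)

end

section \<open>The eigenvalue as a sum over transversals\<close>

text \<open>A permutation of the enlarged set is uniquely a transposition of \<open>a\<close> with
  its image, which must lie in the row of \<open>a\<close>, after a permutation of the old set. This
  multiplies the count by the new size of that row.\<close>

lemma card_permutes_preserving:
  assumes "finite T" "\<And>k. k \<in> T \<Longrightarrow> r k < (N::nat)"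
  shows "card {p. p permutes T \<and> (\<forall>k\<in>T. r (p k) = r k)} = (\<Prod>i<N. fact (card {k\<in>T. r k = i}))"
  using assms
proof (induction T rule: finite_induct)
  case empty
  have "{p. p permutes {} \<and> (\<forall>k\<in>{}. r (p k) = r k)} = {id}" by auto
  then show ?case by simp
next
  case (insert a T)
  let ?P = "\<lambda>T. {p. p permutes T \<and> (\<forall>k\<in>T. r (p k) = r k)}"
  let ?A = "{b \<in> insert a T. r b = r a}"
  have "?P (insert a T) = (\<lambda>(b, p). transpose a b \<circ> p) ` (?A \<times> ?P T)"
  proof (intro equalityI subsetI)
    fix p assume p: "p \<in> ?P (insert a T)"
    then have "p \<in> {p. p permutes insert a T}" by simp
    then obtain b q where bq: "p = transpose a b \<circ> q" "b \<in> insert a T" "q permutes T"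
      unfolding permutes_insert by auto
    have "q a = a" using bq(3) insert.hyps by (simp add: permutes_not_in)
    then have b: "r b = r a" using p bq(1) by auto
    have "r (q k) = r k" if "k \<in> T" for k
    proof -
      have "r (transpose a b (q k)) = r k" using p that bq(1) by auto
      then show ?thesis using b by (auto simp: Transposition.transpose_def split: if_splits)
    qed
    then show "p \<in> (\<lambda>(b, p). transpose a b \<circ> p) ` (?A \<times> ?P T)" using bq b by auto
  next
    fix p assume "p \<in> (\<lambda>(b, p). transpose a b \<circ> p) ` (?A \<times> ?P T)"
    then obtain b q where bq: "p = transpose a b \<circ> q" "b \<in> insert a T" "r b = r a" "q permutes T"
      "\<forall>k\<in>T. r (q k) = r k" by auto
    have "p permutes insert a T" using permutes_insert[of a T] bq by auto
    moreover have "r (p k) = r k" if "k \<in> insert a T" for k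
    proof -
      have "r (p k) = r (q k)" using bq(1,3) by (auto simp: Transposition.transpose_def)
      moreover have "q a = a" using bq(4) insert.hyps by (simp add: permutes_not_in)
      ultimately show ?thesis using that bq(5) by auto
    qed
    ultimately show "p \<in> ?P (insert a T)" by auto
  qed
  moreover have "inj_on (\<lambda>(b, p). transpose a b \<circ> p) (?A \<times> ?P T)"
  proof (rule inj_onI, clarify)
    fix b p b' p'
    assume *: "p permutes T" "p' permutes T" "transpose a b \<circ> p = transpose a b' \<circ> p'"
    have "p a = a" "p' a = a" using * insert.hyps by (simp_all add: permutes_not_in)
    then have "b = b'" using fun_cong[OF *(3), of a] by simp
    moreover have "transpose a b \<circ> (transpose a b \<circ> p) = transpose a b \<circ> (transpose a b \<circ> p')"
      using *(3) \<open>b = b'\<close> by simp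
    ultimately show "b = b' \<and> p = p'" by (simp add: fun_eq_iff)
  qed
  ultimately have "card (?P (insert a T)) = card ?A * card (?P T)"
    by (simp add: card_image card_cartesian_product)
  also have "card (?P T) = (\<Prod>i<N. fact (card {k\<in>T. r k = i}))"
    using insert by auto
  also have "card ?A * \<dots> = (\<Prod>i<N. fact (card {k\<in>insert a T. r k = i}))"
  proof -
    have a: "r a \<in> {..<N}" using insert.prems by auto
    have A: "?A = insert a {k\<in>T. r k = r a}" by auto
    have "card ?A = Suc (card {k\<in>T. r k = r a})"
      unfolding A using insert.hyps by (subst card_insert_disjoint) auto
    moreover have "{k\<in>insert a T. r k = i} = {k\<in>T. r k = i}" if "i \<noteq> r a" for i
      using that by auto
    ultimately show ?thesis
      by (simp add: prod.remove[OF _ a] algebra_simps)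
  qed
  finally show ?case .
qed

context tableau
begin

lemma rows_fixing: "{p\<in>rows. \<forall>k\<in>S. p k = k} =
    {p. p permutes ({1..n} - S) \<and> (\<forall>k\<in>{1..n} - S. r (p k) = r k)}" if "S \<subseteq> {1..n}"
proof (intro equalityI subsetI)
  fix p assume "p \<in> {p\<in>rows. \<forall>k\<in>S. p k = k}"
  then show "p \<in> {p. p permutes ({1..n} - S) \<and> (\<forall>k\<in>{1..n} - S. r (p k) = r k)}"
    by (auto simp: rows_def sym_group_def intro: permutes_superset)
next
  fix p assume p: "p \<in> {p. p permutes ({1..n} - S) \<and> (\<forall>k\<in>{1..n} - S. r (p k) = r k)}"
  have "p permutes {1..n}" using p by (auto intro: permutes_subset)
  moreover have "p k = k" if "k \<in> S" for k using p that by (auto intro: permutes_not_in)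
  ultimately show "p \<in> {p\<in>rows. \<forall>k\<in>S. p k = k}"
    using p by (auto simp: rows_def sym_group_def)
qed

text \<open>If two entries outside \<open>S\<close> share a column, composing with their
  transposition is a sign-reversing involution of the summation range; otherwise only
  \<open>id\<close> is left.\<close>

lemma sum_sign_cols_fixing:
  assumes S: "S \<subseteq> {1..n}"
  shows "(\<Sum>q | q \<in> cols \<and> (\<forall>k\<in>S. q k = k). sign q) = (if inj_on c ({1..n} - S) then 1 else 0)"
proof (cases "inj_on c ({1..n} - S)")
  case True
  have "{q. q \<in> cols \<and> (\<forall>k\<in>S. q k = k)} = {id}"
  proof (intro equalityI subsetI)
    fix q assume q: "q \<in> {q. q \<in> cols \<and> (\<forall>k\<in>S. q k = k)}"
    then have "q permutes {1..n} - S"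
      by (auto simp: cols_def sym_group_def intro: permutes_superset)
    then have "q k \<in> {1..n} - S \<longleftrightarrow> k \<in> {1..n} - S" for k by (rule permutes_in_image)
    moreover have "c (q k) = c k" if "k \<in> {1..n}" for k using q that col_eq by blast
    ultimately have "q k = k" if "k \<in> {1..n} - S" for k
      using True that unfolding inj_on_def by blast
    then have "q k = k" for k using q outside[of q k] cols_sym by (cases "k \<in> S") auto
    then show "q \<in> {id}" by auto
  qed (use id_cols in auto)
  then show ?thesis using True by simp
next
  case False
  then obtain k l where kl: "k \<in> {1..n} - S" "l \<in> {1..n} - S" "k \<noteq> l" "c k = c l"
    by (auto simp: inj_on_def)
  let ?Q = "{q. q \<in> cols \<and> (\<forall>k\<in>S. q k = k)}" and ?t = "transpose k l"
  have t: "?t \<in> cols"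
    using kl by (auto simp: cols_def sym_group_def permutes_swap_id Transposition.transpose_def)
  have tt: "?t \<circ> (?t \<circ> q) = q" for q :: "nat \<Rightarrow> nat" by (auto simp: fun_eq_iff)
  have Q: "?t \<circ> q \<in> ?Q" if "q \<in> ?Q" for q
  proof -
    have "?t \<circ> q \<in> cols" using that by (intro cols_comp t) auto
    moreover have "(?t \<circ> q) i = i" if "i \<in> S" for i
      using \<open>q \<in> ?Q\<close> that kl by (auto simp: Transposition.transpose_def)
    ultimately show ?thesis by blast
  qed
  have "(\<Sum>q\<in>?Q. sign q) = (\<Sum>q\<in>?Q. sign (?t \<circ> q))"
    by (rule sum.reindex_bij_witness[of _ "\<lambda>q. ?t \<circ> q" "\<lambda>q. ?t \<circ> q"])
       (use Q in \<open>auto simp only: tt\<close>)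
  also have "\<dots> = (\<Sum>q\<in>?Q. - sign q)"
    using sym_group_sign[OF cols_sym[OF t] cols_sym] kl
    by (intro sum.cong) (auto simp: sign_swap_id)
  finally have "(\<Sum>q\<in>?Q. sign q) = 0" by (simp add: sum_negf)
  then show ?thesis using False by simp
qed

text \<open>Inclusion-exclusion over a set \<open>S\<close> of common fixed points of
  \<open>p\<close> and \<open>q\<close>. For fixed \<open>S\<close> the sums over \<open>p\<close>
  and \<open>q\<close> separate; the column sum retains only those \<open>S\<close> whose complement
  \<open>T\<close> meets each column at most once, and the row sum counts row-preserving
  permutations of \<open>T\<close>.\<close>

lemma eigenvalue_transversals:
  assumes N: "\<And>k. k \<in> {1..n} \<Longrightarrow> r k < N"
  shows "eigenvalue = of_int (\<Sum>T | T \<subseteq> {1..n} \<and> inj_on c T.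
           (-1) ^ (n + card T) * (\<Prod>i<N. fact (card {k\<in>T. r k = i})))"
proof -
  let ?X = "{1..n}"
  have ind: "(if p \<circ> q \<in> derangements n then sign q else 0) =
     (\<Sum>S\<in>Pow ?X. (-1) ^ card S *
        (of_bool (\<forall>k\<in>S. p k = k) * (of_bool (\<forall>k\<in>S. q k = k) * sign q)))"
    if pq: "p \<in> rows" "q \<in> cols" for p q
  proof -
    have "p \<circ> q \<in> derangements n \<longleftrightarrow> (\<forall>k\<in>?X. \<not> (p k = k \<and> q k = k))"
      using rows_cols_fixed[OF pq] sym_group_comp[OF rows_sym[OF pq(1)] cols_sym[OF pq(2)]]
      by (auto simp: derangements_def)
    then have "(if p \<circ> q \<in> derangements n then sign q else 0) =
        (\<Prod>k\<in>?X. 1 - of_bool (p k = k \<and> q k = k)) * sign q"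
      by (auto intro!: prod.neutral simp: prod_zero_iff)
    also have "(\<Prod>k\<in>?X. 1 - of_bool (p k = k \<and> q k = k) :: int) =
        (\<Sum>S\<in>Pow ?X. (-1) ^ card S * (\<Prod>k\<in>S. of_bool (p k = k \<and> q k = k)))"
      by (subst prod_diff_conv_sum) auto
    also have "\<dots> = (\<Sum>S\<in>Pow ?X. (-1) ^ card S * of_bool (\<forall>k\<in>S. p k = k \<and> q k = k))"
    proof (intro sum.cong refl)
      fix S assume "S \<in> Pow ?X"
      then have "finite S" using finite_subset by auto
      then have "(\<Prod>k\<in>S. of_bool (p k = k \<and> q k = k) :: int) = of_bool (\<forall>k\<in>S. p k = k \<and> q k = k)"
        by (induction S) auto
      then show "(-1) ^ card S * (\<Prod>k\<in>S. of_bool (p k = k \<and> q k = k) :: int) =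
          (-1) ^ card S * of_bool (\<forall>k\<in>S. p k = k \<and> q k = k)" by simp
    qed
    finally show ?thesis
      unfolding sum_distrib_right ball_conj_distrib of_bool_conj mult.assoc .
  qed
  have "eigenvalue = of_int (\<Sum>p\<in>rows. \<Sum>q\<in>cols. if p \<circ> q \<in> derangements n then sign q else 0)"
    unfolding eigenvalue_def by (auto intro!: sum.cong)
  also have "(\<Sum>p\<in>rows. \<Sum>q\<in>cols. if p \<circ> q \<in> derangements n then sign q else 0) =
     (\<Sum>p\<in>rows. \<Sum>q\<in>cols. \<Sum>S\<in>Pow ?X. (-1) ^ card S *
        (of_bool (\<forall>k\<in>S. p k = k) * (of_bool (\<forall>k\<in>S. q k = k) * sign q)))"
    by (intro sum.cong refl ind)
  also have "\<dots> = (\<Sum>p\<in>rows. \<Sum>S\<in>Pow ?X. \<Sum>q\<in>cols. (-1) ^ card S *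
        (of_bool (\<forall>k\<in>S. p k = k) * (of_bool (\<forall>k\<in>S. q k = k) * sign q)))"
    by (intro sum.cong refl sum.swap)
  also have "\<dots> = (\<Sum>S\<in>Pow ?X. \<Sum>p\<in>rows. \<Sum>q\<in>cols. (-1) ^ card S *
        (of_bool (\<forall>k\<in>S. p k = k) * (of_bool (\<forall>k\<in>S. q k = k) * sign q)))"
    by (rule sum.swap)
  also have "\<dots> = (\<Sum>S\<in>Pow ?X. (-1) ^ card S *
      ((\<Sum>p\<in>rows. of_bool (\<forall>k\<in>S. p k = k)) * (\<Sum>q\<in>cols. of_bool (\<forall>k\<in>S. q k = k) * sign q)))"
    unfolding sum_product unfolding sum_distrib_left ..
  also have "\<dots> = (\<Sum>S\<in>Pow ?X. (-1) ^ card S *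
      ((\<Prod>i<N. fact (card {k\<in>?X - S. r k = i})) * of_bool (inj_on c (?X - S))))"
  proof (intro sum.cong refl)
    fix S assume "S \<in> Pow ?X"
    then have S: "S \<subseteq> ?X" by auto
    have "(\<Sum>p\<in>rows. of_bool (\<forall>k\<in>S. p k = k) :: int) = int (card {p\<in>rows. \<forall>k\<in>S. p k = k})"
      using finite_rows by (simp add: sum_of_bool_eq Int_def)
    also have "card {p\<in>rows. \<forall>k\<in>S. p k = k} = (\<Prod>i<N. fact (card {k\<in>?X - S. r k = i}))"
      unfolding rows_fixing[OF S] by (rule card_permutes_preserving) (use N in auto)
    finally have 1: "(\<Sum>p\<in>rows. of_bool (\<forall>k\<in>S. p k = k) :: int) =
       (\<Prod>i<N. fact (card {k\<in>?X - S. r k = i}))" by (simp add: of_nat_prod)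
    have "(\<Sum>q\<in>cols. of_bool (\<forall>k\<in>S. q k = k) * sign q) = (\<Sum>q | q \<in> cols \<and> (\<forall>k\<in>S. q k = k). sign q)"
      by (rule sum.mono_neutral_cong_right) (use finite_cols in auto)
    also have "\<dots> = of_bool (inj_on c (?X - S))" by (simp add: sum_sign_cols_fixing[OF S])
    finally show "(-1) ^ card S * ((\<Sum>p\<in>rows. of_bool (\<forall>k\<in>S. p k = k)) * (\<Sum>q\<in>cols. of_bool (\<forall>k\<in>S. q k = k) * sign q)) =
       (-1) ^ card S * ((\<Prod>i<N. fact (card {k\<in>?X - S. r k = i})) * of_bool (inj_on c (?X - S)))"
      using 1 by simp
  qed
  \<comment> \<open>Passing to the complement T of S, with (-1)^|S| = (-1)^(n + |T|).\<close>
  also have "\<dots> = (\<Sum>T\<in>Pow ?X. (-1) ^ (n + card T) *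
      ((\<Prod>i<N. fact (card {k\<in>T. r k = i})) * of_bool (inj_on c T)))"
  proof (rule sum.reindex_bij_witness[of _ "\<lambda>T. ?X - T" "\<lambda>T. ?X - T"])
    fix S assume "S \<in> Pow ?X"
    then have "card (?X - S) = n - card S" "card S \<le> n"
      using card_mono[of ?X S] by (auto simp: card_Diff_subset finite_subset)
    then show "(-1) ^ (n + card (?X - S)) *
       ((\<Prod>i<N. fact (card {k\<in>?X - S. r k = i})) * of_bool (inj_on c (?X - S))) =
       ((-1) ^ card S * ((\<Prod>i<N. fact (card {k\<in>?X - S. r k = i})) * of_bool (inj_on c (?X - S))) :: int)"
      by (simp add: minus_one_power_iff)
  qed auto
  also have "\<dots> = (\<Sum>T | T \<subseteq> {1..n} \<and> inj_on c T.
           (-1) ^ (n + card T) * (\<Prod>i<N. fact (card {k\<in>T. r k = i})))"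
    by (rule sum.mono_neutral_cong_right) auto
  finally show ?thesis .
qed

section \<open>Column heights and the expansion of the product over columns\<close>

definition height :: "nat \<Rightarrow> nat" where
  "height j = card {k\<in>{1..n}. c k = j}"

text \<open>Absence of gaps makes the rows met by a column an initial segment; \<open>Suc\<close>
  turns rows counted from 0 into variables counted from 1.\<close>

lemma bij_betw_column: "bij_betw (\<lambda>k. Suc (r k)) {k\<in>{1..n}. c k = j} {1..height j}"
proof -
  let ?C = "{k\<in>{1..n}. c k = j}"
  have inj: "inj_on r ?C" using box_inj by (auto simp: inj_on_def)
  have "r ` ?C = {..<card (r ` ?C)}"
  proof (rule card_subset_eq[symmetric])
    show "{..<card (r ` ?C)} \<subseteq> r ` ?C"
    proof
      fix i assume "i \<in> {..<card (r ` ?C)}"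
      then have "\<not> r ` ?C \<subseteq> {..<i}" using card_mono[of "{..<i}" "r ` ?C"] by auto
      then obtain k where k: "k \<in> ?C" "i \<le> r k" by force
      then show "i \<in> r ` ?C" using box_above[of k i] by (cases "i = r k") force+
    qed
  qed auto
  then have "r ` ?C = {..<height j}" using card_image[OF inj] by (simp add: height_def)
  moreover have "{1..m} = Suc ` {..<m}" for m
    by (simp add: lessThan_atLeast0 atLeastLessThanSuc_atLeastAtMost flip: One_nat_def)
  ultimately have "(\<lambda>k. Suc (r k)) ` ?C = {1..height j}" by (metis image_image)
  then show ?thesis using inj by (auto simp: bij_betw_def inj_on_def)
qed

text \<open>The exponent vector of the monomial chosen by \<open>T\<close>. Its entry at 0 is 0, as
  index 0 is reserved for x_1 - 1.\<close>

definition row_counts :: "nat set \<Rightarrow> nat \<Rightarrow> nat" where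
  "row_counts T i = card {k\<in>T. Suc (r k) = i}"

definition transversals :: "nat set \<Rightarrow> nat set set" where
  "transversals J = {T. T \<subseteq> {k\<in>{1..n}. c k \<in> J} \<and> inj_on c T}"

lemma transversals_finite: "finite (transversals J)"
  by (rule finite_subset[of _ "Pow {1..n}"]) (auto simp: transversals_def)

lemma transversals_insert:
  assumes "j \<notin> J"
  shows "transversals (insert j J) = transversals J \<union>
    (\<lambda>(k, T). insert k T) ` ({k\<in>{1..n}. c k = j} \<times> transversals J)"
proof (intro equalityI subsetI)
  fix T assume T: "T \<in> transversals (insert j J)"
  show "T \<in> transversals J \<union> (\<lambda>(k, T). insert k T) ` ({k\<in>{1..n}. c k = j} \<times> transversals J)"
  proof (cases "\<exists>k\<in>T. c k = j")
    case True
    then obtain k where k: "k \<in> T" "c k = j" by blast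
    have "T - {k} \<in> transversals J"
      using T k by (auto simp: transversals_def inj_on_def)
    moreover have "T = insert k (T - {k})" "k \<in> {1..n}" using k T by (auto simp: transversals_def)
    ultimately show ?thesis using k(2) by (intro UnI2 image_eqI[of _ _ "(k, T - {k})"]) auto
  next
    case False
    then show ?thesis using T by (auto simp: transversals_def)
  qed
next
  fix T assume "T \<in> transversals J \<union> (\<lambda>(k, T). insert k T) ` ({k\<in>{1..n}. c k = j} \<times> transversals J)"
  then consider "T \<in> transversals J"
    | k T' where "T = insert k T'" "k \<in> {1..n}" "c k = j" "T' \<in> transversals J" by auto
  then show "T \<in> transversals (insert j J)"
  proof cases
    case 1
    then show ?thesis by (auto simp: transversals_def)
  next
    case (2 k T')
    then have "j \<notin> c ` (T' - {k})" using assms by (auto simp: transversals_def)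
    then show ?thesis using 2 by (auto simp: transversals_def)
  qed
qed

text \<open>Expanding the product, each column contributes either -1, when \<open>T\<close> skips
  it, or the variable of the row in which \<open>T\<close> meets it. The exponent
  \<open>length js + card T\<close> has the parity of the number of skipped columns.\<close>

lemma colsum_eq_transversals:
  assumes "distinct js" "t 0 = 0"
  shows "colsum N (map height js) t =
    (\<Sum>T\<in>transversals (set js). (-1) ^ (length js + card T) * weight N (\<lambda>i. t i + row_counts T i))"
  using assms
proof (induction js arbitrary: t)
  case Nil
  have "transversals {} = {{}}" by (auto simp: transversals_def)
  then show ?case by (simp add: row_counts_def)
next
  case (Cons j js)
  let ?C = "{k\<in>{1..n}. c k = j}" and ?Tr = "transversals (set js)"
  let ?g = "\<lambda>T. (-1) ^ (length (j # js) + card T) * weight N (\<lambda>i. t i + row_counts T i)"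
  have j: "j \<notin> set js" using Cons.prems by simp
  have fresh: "k \<notin> T" "finite T" if "k \<in> ?C" "T \<in> ?Tr" for k T
  proof -
    show "k \<notin> T" using that j by (auto simp: transversals_def)
    have "T \<subseteq> {1..n}" using that(2) by (auto simp: transversals_def)
    then show "finite T" by (rule finite_subset) simp
  qed
  have "(\<Sum>T\<in>transversals (set (j # js)). ?g T) =
      (\<Sum>T\<in>?Tr. ?g T) + (\<Sum>T\<in>(\<lambda>(k, T). insert k T) ` (?C \<times> ?Tr). ?g T)"
    unfolding list.set transversals_insert[OF j]
  proof (rule sum.union_disjoint)
    show "?Tr \<inter> (\<lambda>(k, T). insert k T) ` (?C \<times> ?Tr) = {}"
      using j by (auto simp: transversals_def)
  qed (auto simp: transversals_finite)
  also have "(\<Sum>T\<in>?Tr. ?g T) = - colsum N (map height js) t"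
    using Cons by (simp add: sum_negf)
  also have "(\<Sum>T\<in>(\<lambda>(k, T). insert k T) ` (?C \<times> ?Tr). ?g T) = (\<Sum>(k, T)\<in>?C \<times> ?Tr. ?g (insert k T))"
  proof (subst sum.reindex)
    show "inj_on (\<lambda>(k, T). insert k T) (?C \<times> ?Tr)"
    proof (rule inj_onI, clarify)
      fix k T k' T'
      assume *: "T \<in> ?Tr" "T' \<in> ?Tr" "insert k T = insert k' T'" "j = c k" "c k' = c k" "k \<in> {1..n}" "k' \<in> {1..n}"
      have "k \<notin> T'" "k' \<notin> T" "k \<notin> T" "k' \<notin> T'" using * j by (auto simp: transversals_def)
      then show "k = k' \<and> T = T'" using *(3) by (metis insertE insertI1 insert_ident)
    qed
  qed (auto intro!: sum.cong)
  also have "\<dots> = (\<Sum>k\<in>?C. \<Sum>T\<in>?Tr. ?g (insert k T))" by (rule sum.cartesian_product[symmetric])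
  also have "\<dots> = (\<Sum>k\<in>?C. colsum N (map height js) (inc (Suc (r k)) t))"
  proof (rule sum.cong[OF refl])
    fix k assume k: "k \<in> ?C"
    have "colsum N (map height js) (inc (Suc (r k)) t) =
      (\<Sum>T\<in>?Tr. (-1) ^ (length js + card T) * weight N (\<lambda>i. inc (Suc (r k)) t i + row_counts T i))"
      using Cons.prems by (intro Cons.IH) (auto simp: inc_def)
    also have "\<dots> = (\<Sum>T\<in>?Tr. ?g (insert k T))"
    proof (rule sum.cong[OF refl])
      fix T assume T: "T \<in> ?Tr"
      have "row_counts (insert k T) i = row_counts T i + of_bool (i = Suc (r k))" for i
      proof -
        have "{l\<in>insert k T. Suc (r l) = i} =
            (if i = Suc (r k) then insert k {l\<in>T. Suc (r l) = i} else {l\<in>T. Suc (r l) = i})" by auto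
        then show ?thesis using fresh[OF k T] by (simp add: row_counts_def)
      qed
      then have "(\<lambda>i. inc (Suc (r k)) t i + row_counts T i) = (\<lambda>i. t i + row_counts (insert k T) i)"
        by (auto simp: inc_def)
      then show "(-1) ^ (length js + card T) * weight N (\<lambda>i. inc (Suc (r k)) t i + row_counts T i) = ?g (insert k T)"
        using fresh[OF k T] by simp
    qed
    finally show "(\<Sum>T\<in>?Tr. ?g (insert k T)) = colsum N (map height js) (inc (Suc (r k)) t)" ..
  qed
  also have "\<dots> = (\<Sum>i=1..height j. colsum N (map height js) (inc i t))"
    by (rule sum.reindex_bij_betw[OF bij_betw_column])
  finally show ?case by simp
qed

text \<open>Without powers of x_1 - 1 the weight is a plain product of factorials, so both sides are
  the same sum over transversals; the sign accounts for \<open>n\<close> in one exponent and the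
  number of columns in the other.\<close>

lemma eigenvalue_eq_colsum:
  assumes N: "\<And>k. k \<in> {1..n} \<Longrightarrow> r k < N" "1 \<le> N" and js: "distinct js" "c ` {1..n} \<subseteq> set js"
  shows "eigenvalue = of_int ((-1) ^ (n + length js) * colsum N (map height js) (\<lambda>_. 0))"
proof -
  have w: "weight N (row_counts T) = (\<Prod>i<N. fact (card {k\<in>T. r k = i}))" for T
  proof -
    have "row_counts T 0 = 0" by (simp add: row_counts_def)
    then have "weight N (row_counts T) = (\<Prod>i=1..N. fact (row_counts T i))"
      using N(2) prod.atLeast_Suc_atMost[of 1 N "\<lambda>i. fact (row_counts T i) :: int"]
      by (simp add: weight_def numeral_2_eq_2)
    also have "\<dots> = (\<Prod>i<N. fact (row_counts T (Suc i)))"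
      by (rule prod.reindex_bij_witness[of _ Suc "\<lambda>i. i - 1"]) auto
    finally show ?thesis by (simp add: row_counts_def)
  qed
  have Tr: "transversals (set js) = {T. T \<subseteq> {1..n} \<and> inj_on c T}"
    using js(2) by (auto simp: transversals_def)
  have "colsum N (map height js) (\<lambda>_. 0) = (\<Sum>T\<in>transversals (set js).
      (-1) ^ (length js + card T) * weight N (\<lambda>i. 0 + row_counts T i))"
    by (rule colsum_eq_transversals[OF js(1)]) simp
  then have "(-1) ^ (n + length js) * colsum N (map height js) (\<lambda>_. 0) =
     (\<Sum>T | T \<subseteq> {1..n} \<and> inj_on c T. (-1) ^ (n + card T) * (\<Prod>i<N. fact (card {k\<in>T. r k = i})))"
    unfolding Tr by (simp add: w sum_distrib_left power_add mult.assoc)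
  then show ?thesis by (simp only: eigenvalue_transversals[OF N(1)])
qed

end

section \<open>Partitions and their conjugates\<close>

lemma partition_nth_antimono:
  assumes "lam \<turnstile> n" "i \<le> j" "j < length lam"
  shows "lam ! j \<le> lam ! i"
  using assms by (cases "i = j") (auto simp: partition_of_def sorted_wrt_iff_nth_less)

text \<open>Row \<open>i\<close> holds the entries above \<open>sum_list (take i lam)\<close> up to
  the next prefix sum; \<open>1 \<le> j\<close> keeps the entry out of all earlier rows.\<close>

lemma tab_box:
  assumes "i < length lam" "1 \<le> j" "j \<le> lam ! i"
  shows "tab_row lam (sum_list (take i lam) + j) = i" "tab_col lam (sum_list (take i lam) + j) = j"
proof -
  show row: "tab_row lam (sum_list (take i lam) + j) = i"
    unfolding tab_row_def
  proof (rule Least_equality)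
    show "sum_list (take i lam) + j \<le> sum_list (take (Suc i) lam)"
      using assms by (simp add: take_Suc_conv_app_nth)
    fix l assume l: "sum_list (take i lam) + j \<le> sum_list (take (Suc l) lam)"
    show "i \<le> l"
    proof (rule ccontr)
      assume "\<not> i \<le> l"
      then have "take i lam = take (Suc l) lam @ take (i - Suc l) (drop (Suc l) lam)"
        by (metis le_add_diff_inverse not_less_eq_eq take_add)
      then have "sum_list (take (Suc l) lam) \<le> sum_list (take i lam)" by simp
      then show False using l assms(2) by simp
    qed
  qed
  show "tab_col lam (sum_list (take i lam) + j) = j" by (simp add: tab_col_def row)
qed

lemma tab_box_exists:
  fixes lam :: "nat list"
  assumes "1 \<le> k" "k \<le> sum_list lam"
  shows "\<exists>i j. i < length lam \<and> 1 \<le> j \<and> j \<le> lam ! i \<and> k = sum_list (take i lam) + j"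
  using assms
proof (induction lam arbitrary: k)
  case (Cons a lam)
  show ?case
  proof (cases "k \<le> a")
    case True
    then show ?thesis using Cons.prems by (intro exI[of _ 0] exI[of _ k]) auto
  next
    case False
    have "\<exists>i j. i < length lam \<and> 1 \<le> j \<and> j \<le> lam ! i \<and> k - a = sum_list (take i lam) + j"
      by (rule Cons.IH) (use False Cons.prems in auto)
    then obtain i j where "i < length lam" "1 \<le> j" "j \<le> lam ! i" "k - a = sum_list (take i lam) + j"
      by blast
    then show ?thesis using False by (intro exI[of _ "Suc i"] exI[of _ j]) auto
  qed
qed simp

lemma sum_list_take_box:
  assumes "i < length lam" "j \<le> lam ! i"
  shows "sum_list (take i lam) + j \<le> sum_list (lam :: nat list)"
proof -
  have "sum_list lam = sum_list (take (Suc i) lam) + sum_list (drop (Suc i) lam)"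
    by (metis append_take_drop_id sum_list_append)
  then show ?thesis using assms by (simp add: take_Suc_conv_app_nth)
qed

lemma tab_cases:
  assumes "k \<in> {1..sum_list lam}"
  shows "tab_row lam k < length lam" "1 \<le> tab_col lam k" "tab_col lam k \<le> lam ! tab_row lam k"
    "k = sum_list (take (tab_row lam k) lam) + tab_col lam k"
  using tab_box_exists[of k lam] assms tab_box[of _ lam] by auto

text \<open>A box determines its entry, and columns have no gaps because earlier parts are at least
  as large.\<close>

lemma tableau_partition:
  assumes "lam \<turnstile> n"
  shows "tableau n (tab_row lam) (tab_col lam)"
proof
  have n: "sum_list lam = n" using assms by (simp add: partition_of_def)
  fix k l assume kl: "k \<in> {1..n}" "l \<in> {1..n}" "tab_row lam k = tab_row lam l" "tab_col lam k = tab_col lam l"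
  then show "k = l" using tab_cases(4)[of k lam] tab_cases(4)[of l lam] n by metis
next
  have n: "sum_list lam = n" using assms by (simp add: partition_of_def)
  fix k i assume k: "k \<in> {1..n}" "i < tab_row lam k"
  have k': "k \<in> {1..sum_list lam}" using k n by simp
  have box: "i < length lam" "1 \<le> tab_col lam k" "tab_col lam k \<le> lam ! i"
    using tab_cases(1-3)[OF k'] k partition_nth_antimono[OF assms, of i "tab_row lam k"] by auto
  let ?l = "sum_list (take i lam) + tab_col lam k"
  have "?l \<in> {1..n}" using sum_list_take_box[OF box(1,3)] box(2) n by simp
  then show "\<exists>l\<in>{1..n}. tab_row lam l = i \<and> tab_col lam l = tab_col lam k"
    using tab_box[OF box] by blast
qed

text \<open>The length of column \<open>j\<close> of the diagram, that is, the \<open>j\<close>-th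
  part of the conjugate partition.\<close>

definition conj_col :: "nat list \<Rightarrow> nat \<Rightarrow> nat" where
  "conj_col lam j = length (filter (\<lambda>x. j \<le> x) lam)"

lemma tab_height:
  assumes "lam \<turnstile> n" "1 \<le> j"
  shows "card {k\<in>{1..n}. tab_col lam k = j} = conj_col lam j"
proof -
  have n: "sum_list lam = n" using assms by (simp add: partition_of_def)
  have "bij_betw (\<lambda>i. sum_list (take i lam) + j) {i. i < length lam \<and> j \<le> lam ! i} {k\<in>{1..n}. tab_col lam k = j}"
  proof (rule bij_betw_byWitness[of _ "tab_row lam"])
    show "\<forall>i\<in>{i. i < length lam \<and> j \<le> lam ! i}. tab_row lam (sum_list (take i lam) + j) = i"
      using tab_box assms(2) by auto
    show "\<forall>k\<in>{k\<in>{1..n}. tab_col lam k = j}. sum_list (take (tab_row lam k) lam) + j = k"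
      using tab_cases(4) n by auto
    show "(\<lambda>i. sum_list (take i lam) + j) ` {i. i < length lam \<and> j \<le> lam ! i} \<subseteq> {k\<in>{1..n}. tab_col lam k = j}"
    proof (clarify, intro conjI)
      fix i assume i: "i < length lam" "j \<le> lam ! i"
      show "sum_list (take i lam) + j \<in> {1..n}" using sum_list_take_box[OF i] assms(2) n by simp
      show "tab_col lam (sum_list (take i lam) + j) = j" using tab_box(2)[OF i(1) assms(2) i(2)] .
    qed
    show "tab_row lam ` {k\<in>{1..n}. tab_col lam k = j} \<subseteq> {i. i < length lam \<and> j \<le> lam ! i}"
    proof clarify
      fix k assume "k \<in> {1..n}"
      then have "k \<in> {1..sum_list lam}" using n by simp
      then show "tab_row lam k < length lam \<and> tab_col lam k \<le> lam ! tab_row lam k"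
        using tab_cases by blast
    qed
  qed
  from bij_betw_same_card[OF this] show ?thesis
    by (simp add: conj_col_def length_filter_conv_card)
qed

definition conj_part :: "nat list \<Rightarrow> nat list" where
  "conj_part lam = map (conj_col lam) [1..<Suc (hd lam)]"

lemma partition_le_hd: "lam \<turnstile> n \<Longrightarrow> x \<in> set lam \<Longrightarrow> x \<le> hd lam"
  by (cases lam) (auto simp: partition_of_def)

lemma conj_part_props:
  assumes "lam \<turnstile> n" "1 \<le> n"
  shows "length (conj_part lam) = hd lam" "sum_list (conj_part lam) = n" "\<forall>x\<in>set (conj_part lam). 1 \<le> x"
    "conj_part lam \<noteq> []"
proof -
  have ne: "lam \<noteq> []" using assms by (auto simp: partition_of_def)
  show "length (conj_part lam) = hd lam" by (simp add: conj_part_def)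
  show "conj_part lam \<noteq> []"
    using ne assms by (cases lam) (auto simp: conj_part_def partition_of_def)
  show "\<forall>x\<in>set (conj_part lam). 1 \<le> x"
    using ne by (cases lam) (auto simp: conj_part_def conj_col_def)
  \<comment> \<open>The bound \<open>m\<close> stays fixed while the parts are added one by one; a
    part \<open>x\<close> lengthens the columns 1 to \<open>x\<close> by one box each.\<close>
  have "(\<Sum>j\<leftarrow>[1..<Suc m]. conj_col xs j) = sum_list xs" if "\<forall>x\<in>set xs. x \<le> m" for m xs
    using that
  proof (induction xs)
    case Nil
    then show ?case by (simp add: conj_col_def sum_list_0)
  next
    case (Cons x xs)
    have "(\<Sum>j\<leftarrow>[1..<Suc m]. conj_col (x # xs) j) = (\<Sum>j=1..<Suc m. conj_col (x # xs) j)"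
      by (rule interv_sum_list_conv_sum_set_nat[simplified])
    also have "\<dots> = (\<Sum>j=1..<Suc m. conj_col xs j + of_bool (j \<le> x))"
      by (intro sum.cong) (auto simp: conj_col_def)
    also have "\<dots> = (\<Sum>j=1..<Suc m. conj_col xs j) + (\<Sum>j=1..<Suc m. of_bool (j \<le> x))"
      by (rule sum.distrib)
    also have "(\<Sum>j=1..<Suc m. of_bool (j \<le> x)) = card ({1..<Suc m} \<inter> {j. j \<le> x})"
      by (simp only: sum_of_bool_eq finite_atLeastLessThan of_nat_id)
    also have "{1..<Suc m} \<inter> {j. j \<le> x} = {1..x}" using Cons.prems by auto
    also have "(\<Sum>j=1..<Suc m. conj_col xs j) = (\<Sum>j\<leftarrow>[1..<Suc m]. conj_col xs j)"
      by (rule interv_sum_list_conv_sum_set_nat[simplified, symmetric])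
    also have "\<dots> = sum_list xs" using Cons by simp
    finally show ?case by simp
  qed
  then show "sum_list (conj_part lam) = n"
    using partition_le_hd[OF assms(1)] assms(1) by (auto simp: conj_part_def partition_of_def)
qed

text \<open>Parts are positive, so there are at most \<open>n\<close> rows and \<open>n\<close>
  variables serve every shape of size \<open>n\<close>; values for different shapes can thus be
  compared within \<open>colsum n\<close>. The sign depends only on \<open>n\<close> and the number
  of columns.\<close>

lemma eta_eq_colsum:
  assumes "lam \<turnstile> n" "1 \<le> n"
  shows "eta lam = of_int ((-1) ^ (n + hd lam) * colsum n (conj_part lam) (\<lambda>_. 0))"
proof -
  have n: "sum_list lam = n" using assms by (simp add: partition_of_def)
  interpret tableau n "tab_row lam" "tab_col lam" by (rule tableau_partition[OF assms(1)])
  have "symmetrizer = young_symmetrizer lam"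
    by (simp add: symmetrizer_def young_symmetrizer_def rows_def cols_def row_group_def col_group_def n)
  then have "irrep = irrep_space lam" by (simp add: irrep_def irrep_space_def n)
  then have "eta lam = eigenvalue"
    using trace_eq_eigenvalue by (simp add: eta_def irr_char_def n)
  also have "eigenvalue = of_int ((-1) ^ (n + length [1..<Suc (hd lam)]) * colsum n (map height [1..<Suc (hd lam)]) (\<lambda>_. 0))"
  proof (rule eigenvalue_eq_colsum)
    have "length l \<le> sum_list l" if "\<forall>x\<in>set l. 1 \<le> x" for l :: "nat list"
      using that by (induction l) auto
    then have "length lam \<le> n" using assms by (auto simp: partition_of_def)
    then show "tab_row lam k < n" if "k \<in> {1..n}" for k
      using tab_cases(1)[of k lam] that n by simp
    show "tab_col lam ` {1..n} \<subseteq> set [1..<Suc (hd lam)]"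
    proof
      fix j assume "j \<in> tab_col lam ` {1..n}"
      then obtain k where k: "k \<in> {1..sum_list lam}" "j = tab_col lam k" using n by auto
      then show "j \<in> set [1..<Suc (hd lam)]"
        using tab_cases(1-3)[OF k(1)] partition_le_hd[OF assms(1), of "lam ! tab_row lam k"] by auto
    qed
  qed (use assms in auto)
  also have "map height [1..<Suc (hd lam)] = conj_part lam"
    unfolding conj_part_def using tab_height[OF assms(1)] by (auto simp: height_def)
  finally show ?thesis by (simp del: upt_Suc)
qed

text \<open>All column lengths are positive, so \<open>colsum_nonneg\<close> leaves only the sign
  for the modulus to remove.\<close>

lemma cmod_eta:
  assumes "lam \<turnstile> n" "1 \<le> n"
  shows "cmod (eta lam) = of_int (colsum n (conj_part lam) (\<lambda>_. 0))"
  using colsum_nonneg[of "conj_part lam" n "\<lambda>_. 0"] conj_part_props(3)[OF assms]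
  by (simp add: eta_eq_colsum[OF assms] norm_mult norm_power)

section \<open>The lexicographically largest shape and the two bounds\<close>

lemma sorted_wrt_ge_replicate: "sorted_wrt (\<ge>) (replicate m (x :: nat))"
  by (induction m) auto

text \<open>A rival first exceeding this shape among the full rows would have a part above
  \<open>k\<close>; one first exceeding it at the remainder would have a sum above
  \<open>n\<close>.\<close>

lemma lex_largest_eq:
  assumes "lex_largest_with_first_part n k mu" "1 \<le> k" "k \<le> n"
  shows "mu = replicate (n div k) k @ (if n mod k = 0 then [] else [n mod k])"
proof (rule ccontr)
  let ?nu = "replicate (n div k) k @ (if n mod k = 0 then [] else [n mod k])"
  assume neq: "mu \<noteq> ?nu"
  have mu: "mu \<turnstile> n" "hd mu = k" using assms(1) by (auto simp: lex_largest_with_first_part_def)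
  have "n mod k \<le> k" using assms(2) by (simp add: less_imp_le)
  then have nu: "?nu \<turnstile> n"
    using assms(2) by (auto simp: partition_of_def sorted_wrt_append sum_list_replicate sorted_wrt_ge_replicate)
  have "0 < n div k" using assms by (simp add: div_greater_zero_iff)
  then have "hd ?nu = k" by (cases "n div k") auto
  then have "?nu <\<^sub>l\<^sub>e\<^sub>x mu"
    using assms(1) nu neq unfolding lex_largest_with_first_part_def by metis
  then obtain m where m: "m < length ?nu" "m < length mu" "\<forall>i<m. ?nu ! i = mu ! i" "?nu ! m < mu ! m"
    unfolding lex_less_def by blast
  show False
  proof (cases "m < n div k")
    case True
    then have "?nu ! m = k" by (simp add: nth_append)
    moreover have "mu ! m \<le> k" using partition_le_hd[OF mu(1)] mu(2) m(2) by auto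
    ultimately show False using m(4) by simp
  next
    case False
    then have *: "n mod k \<noteq> 0" "m = n div k" using m(1) by (auto split: if_splits)
    have "take m mu = take m ?nu"
    proof (rule nth_equalityI)
      fix i assume "i < length (take m mu)"
      then have "i < m" by simp
      then show "take m mu ! i = take m ?nu ! i" using m(3) by (simp only: nth_take)
    qed (use m(1,2) in simp)
    then have "sum_list (take m mu) = n div k * k" by (simp add: * sum_list_replicate)
    moreover have "sum_list (take m mu) + mu ! m \<le> n"
      using sum_list_take_box[OF m(2), of "mu ! m"] mu(1) by (simp add: partition_of_def)
    moreover have "?nu ! m = n mod k" using * by (simp add: nth_append)
    then have "n mod k < mu ! m" using m(4) by simp
    ultimately show False using div_mult_mod_eq[of n k] by linarith
  qed
qed

theorem theorem1p7:
  fixes n :: nat and lam lamstar :: "nat list"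
  assumes "n \<ge> 1"
    and "lam \<turnstile> n"
    and "lex_largest_with_first_part n (hd lam) lamstar"
  shows "cmod (eta (hd lam # replicate (n - hd lam) 1)) \<le> cmod (eta lam)
       \<and> cmod (eta lam) \<le> cmod (eta lamstar)"
proof
  let ?k = "hd lam" and ?U = "\<lambda>cs. colsum n cs (\<lambda>_. 0)"
  let ?hook = "?k # replicate (n - ?k) 1"
  note props = conj_part_props[OF assms(2,1)]
  have ne: "lam \<noteq> []" using assms by (auto simp: partition_of_def)
  then have k: "1 \<le> ?k" "?k \<le> n"
    using assms(2) by (cases lam; auto simp: partition_of_def)+
  have hook: "?hook \<turnstile> n"
    using k by (auto simp: partition_of_def sum_list_replicate sorted_wrt_ge_replicate)
  \<comment> \<open>The conjugate of a hook is a hook: its first column has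
    \<open>n - ?k + 1\<close> boxes and the other \<open>?k - 1\<close> columns have one box
    each.\<close>
  have "conj_part ?hook = (n - (?k - 1)) # replicate (?k - 1) 1"
  proof (rule nth_equalityI)
    fix i assume "i < length (conj_part ?hook)"
    then have i: "i < ?k" by (simp add: conj_part_def del: upt_Suc)
    then have "conj_part ?hook ! i = conj_col ?hook (Suc i)" by (simp add: conj_part_def del: upt_Suc)
    then show "conj_part ?hook ! i = ((n - (?k - 1)) # replicate (?k - 1) 1) ! i"
      using i k by (cases i) (auto simp: conj_col_def)
  qed (use k in \<open>simp add: conj_part_def del: upt_Suc\<close>)
  moreover obtain c cs where cs: "conj_part lam = c # cs"
    using props(4) by (cases "conj_part lam") auto
  moreover have "length cs = ?k - 1" using props(1) cs by simp
  ultimately have "?U (conj_part ?hook) \<le> ?U (conj_part lam)"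
    using colsum_ge_hook[of c cs n "\<lambda>_. 0"] props(2,3) by (simp del: colsum.simps)
  then show "cmod (eta ?hook) \<le> cmod (eta lam)"
    unfolding cmod_eta[OF hook assms(1)] cmod_eta[OF assms(2,1)] by (simp only: of_int_le_iff)
  have star: "lamstar \<turnstile> n" "hd lamstar = ?k"
    using assms(3) by (auto simp: lex_largest_with_first_part_def)
  note star_props = conj_part_props[OF star(1) assms(1)]
  have "?U (conj_part lam) \<le> ?U (conj_part lamstar)"
  proof (rule colsum_le_balanced)
    \<comment> \<open>Each of the \<open>n div ?k\<close> full rows meets every column, and a
      remainder row adds one box to the first \<open>n mod ?k\<close> columns only.\<close>
    have vals: "n div ?k \<le> x \<and> x \<le> n div ?k + 1" if "x \<in> set (conj_part lamstar)" for x
      using that star(2) unfolding conj_part_def lex_largest_eq[OF assms(3) k]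
      by (auto simp: conj_col_def)
    then show "a < b + 2" if "a \<in> set (conj_part lamstar)" "b \<in> set (conj_part lamstar)" for a b
      using vals[OF that(1)] vals[OF that(2)] by linarith
  qed (use props star_props star in auto)
  then show "cmod (eta lam) \<le> cmod (eta lamstar)"
    unfolding cmod_eta[OF star(1) assms(1)] cmod_eta[OF assms(2,1)] by (simp only: of_int_le_iff)
qed

end
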